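(* Let $p\geq 0$ and let $G$ be a balanced bipartite graph of order $2n$ with minimum degree $\delta(G)\geq k$, where $n\geq (k+2)(k-p+1)$. If $k\geq p+1$ and $q(G)\geq q(M_{n,n}^{n-k,k-p})$, then $G$ is $2p$-Hamilton-biconnected unless $G= M_{n,n}^{n-k,k-p}$.
   Context: $q(G)$ is the signless Laplacian spectral radius, i.e. the largest eigenvalue of $D(G)+A(G)$ where $D(G)$ is the diagonal degree matrix and $A(G)$ the adjacency matrix. A bipartite graph $G=(X,Y;E)$ is balanced if $|X|=|Y|$; it is Hamilton-biconnected if for every $u\in X$, $v\in Y$ there is a Hamiltonian path with ends $u,v$. A vertex set $W$ is balanced if $|W\cap X|=|W\cap Y|$; $G$ is $2p$-Hamilton-biconnected if for every balanced $W$ with $|W|=2p$, the subgraph induced by $V(G)\setminus W$ is Hamilton-biconnected. $M_{n,m}^{s,t}$: parts $X=X_1\cup X_2$, $Y=Y_1\cup Y_2$, $|X_1|=s$, $|X_2|=n-s$, $|Y_1|=m-t$, $|Y_2|=t$; edges are all pairs between $X_1$ and $Y_1$, between $X_2$ and $Y_1$, and between $X_2$ and $Y_2$. "$G=H$" means isomorphic. *)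

theory Defs
  imports Complex_Main
begin

definition bipartite_graph :: "'a set \<Rightarrow> 'a set \<Rightarrow> 'a set set \<Rightarrow> bool" where
  "bipartite_graph X Y E \<longleftrightarrow> finite X \<and> finite Y \<and> X \<inter> Y = {} \<and>
     E \<subseteq> {{x, y} | x y. x \<in> X \<and> y \<in> Y}"

definition adj :: "'a set set \<Rightarrow> 'a \<Rightarrow> 'a \<Rightarrow> bool" where
  "adj E x y \<longleftrightarrow> {x, y} \<in> E"

definition degree :: "'a set \<Rightarrow> 'a set set \<Rightarrow> 'a \<Rightarrow> nat" where
  "degree V E x = card {y \<in> V. adj E x y}"

definition signless_laplacian :: "'a set \<Rightarrow> 'a set set \<Rightarrow> 'a \<Rightarrow> 'a \<Rightarrow> real" where
  "signless_laplacian V E x y =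
     (if x = y then real (degree V E x) else 0) + (if adj E x y then 1 else 0)"

text \<open>Eigenvalues of Q (Q is real symmetric, so all eigenvalues are real).\<close>
definition Q_eigenvalues :: "'a set \<Rightarrow> 'a set set \<Rightarrow> real set" where
  "Q_eigenvalues V E = {mu. \<exists>v :: 'a \<Rightarrow> real. (\<exists>x\<in>V. v x \<noteq> 0) \<and>
      (\<forall>x\<in>V. (\<Sum>y\<in>V. signless_laplacian V E x y * v y) = mu * v x)}"

definition q_radius :: "'a set \<Rightarrow> 'a set set \<Rightarrow> real" where
  "q_radius V E = Max (Q_eigenvalues V E)"

definition ham_path :: "'a set set \<Rightarrow> 'a set \<Rightarrow> 'a \<Rightarrow> 'a \<Rightarrow> 'a list \<Rightarrow> bool" where
  "ham_path E S u v ps \<longleftrightarrow> ps \<noteq> [] \<and> distinct ps \<and> set ps = S \<and>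
     hd ps = u \<and> last ps = v \<and> (\<forall>i. Suc i < length ps \<longrightarrow> adj E (ps ! i) (ps ! Suc i))"

definition ham_biconnected :: "'a set \<Rightarrow> 'a set \<Rightarrow> 'a set set \<Rightarrow> bool" where
  "ham_biconnected X Y E \<longleftrightarrow>
     (\<forall>u\<in>X. \<forall>v\<in>Y. \<exists>ps. ham_path E (X \<union> Y) u v ps)"

definition ham_biconnected_2p :: "nat \<Rightarrow> 'a set \<Rightarrow> 'a set \<Rightarrow> 'a set set \<Rightarrow> bool" where
  "ham_biconnected_2p p X Y E \<longleftrightarrow>
     (\<forall>W. W \<subseteq> X \<union> Y \<longrightarrow> card (W \<inter> X) = card (W \<inter> Y) \<longrightarrow> card W = 2 * p \<longrightarrow>
        ham_biconnected (X - W) (Y - W) E)"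

definition graph_iso :: "'a set \<Rightarrow> 'a set set \<Rightarrow> 'b set \<Rightarrow> 'b set set \<Rightarrow> bool" where
  "graph_iso V E V' E' \<longleftrightarrow> (\<exists>f. bij_betw f V V' \<and>
     (\<forall>x\<in>V. \<forall>y\<in>V. adj E x y \<longleftrightarrow> adj E' (f x) (f y)))"

text \<open>The graph M_{n,m}^{s,t} on vertices (0,i), i<n (class X) and (1,j), j<m (class Y);
  X1 = {(0,i) | i<s}, X2 = {(0,i) | s\<le>i<n}, Y1 = {(1,j) | j<m-t}, Y2 = {(1,j) | m-t\<le>j<m}.
  Edges: X1-Y1, X2-Y1, X2-Y2 (all pairs).\<close>
definition M_X :: "nat \<Rightarrow> (nat \<times> nat) set" where
  "M_X n = {(0, i) | i. i < n}"

definition M_Y :: "nat \<Rightarrow> (nat \<times> nat) set" where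
  "M_Y m = {(1, j) | j. j < m}"

definition M_E :: "nat \<Rightarrow> nat \<Rightarrow> nat \<Rightarrow> nat \<Rightarrow> (nat \<times> nat) set set" where
  "M_E n m s t = {{(0, i), (1, j)} | i j. i < n \<and> j < m \<and>
      ((i < s \<and> j < m - t) \<or> (s \<le> i \<and> j < m - t) \<or> (s \<le> i \<and> m - t \<le> j))}"

end

theory Submission
  imports "HOL-Analysis.Function_Topology" Defs
begin

text \<open>Put t = k - p. The degrees are a Collatz--Wielandt weight giving q(G) \<le> n + e(G)/n, while a
  test vector gives q(M) > 2n - t, so fewer than nt edges are missing from G. If deleting W
  leaves no Hamiltonian path from u to v, complete G - W to an edge-maximal graph without such a path:
  there, with m = n - p, non-adjacent x and y have d(x) + d(y) \<le> m + 1, with equality only if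
  x is adjacent to v and y to u. Counting missing edges around a non-adjacent pair of maximal degree sum
  leaves two possibilities: t vertices on one side have degree at most k in G, or t = 2 and two
  adjacent vertices have degree at most k. In the first case, shifting the neighbourhoods of the t
  low vertices onto the k largest entries of a Perron vector shows q(G) \<le> q(M), with equality
  only for G = M. In the second case an explicit weight and a test vector separate q(G) < q(M).\<close>

section \<open>Bipartite graphs\<close>

definition nbhd :: "'a set \<Rightarrow> 'a set set \<Rightarrow> 'a \<Rightarrow> 'a set" where
  "nbhd V E x = {y \<in> V. adj E x y}"

definition adj_pairs :: "'a set \<Rightarrow> 'a set \<Rightarrow> 'a set set \<Rightarrow> ('a \<times> 'a) set" where
  "adj_pairs X Y E = {(x, y). x \<in> X \<and> y \<in> Y \<and> adj E x y}"

definition non_adj_pairs :: "'a set \<Rightarrow> 'a set \<Rightarrow> 'a set set \<Rightarrow> ('a \<times> 'a) set" where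
  "non_adj_pairs X Y E = {(x, y). x \<in> X \<and> y \<in> Y \<and> \<not> adj E x y}"

definition induced_edges :: "'a set set \<Rightarrow> 'a set \<Rightarrow> 'a set set" where
  "induced_edges E S = {e \<in> E. e \<subseteq> S}"

lemma adj_sym: "adj E x y \<longleftrightarrow> adj E y x"
  by (simp add: adj_def insert_commute)

lemma adj_mono: "E \<subseteq> F \<Longrightarrow> adj E x y \<Longrightarrow> adj F x y"
  by (auto simp: adj_def)

lemma adj_induced_edges: "adj (induced_edges E S) x y \<longleftrightarrow> adj E x y \<and> x \<in> S \<and> y \<in> S"
  by (auto simp: adj_def induced_edges_def)

lemma in_nbhd: "y \<in> nbhd V E x \<longleftrightarrow> y \<in> V \<and> adj E x y"
  by (simp add: nbhd_def)

lemma card_nbhd: "card (nbhd V E x) = degree V E x"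
  by (simp add: nbhd_def degree_def)

lemma finite_nbhd: "finite V \<Longrightarrow> finite (nbhd V E x)"
  by (simp add: nbhd_def)

lemma nbhd_mono: "E \<subseteq> F \<Longrightarrow> nbhd V E x \<subseteq> nbhd V F x"
  by (auto simp: nbhd_def intro: adj_mono)

lemma degree_mono:
  assumes "finite V" "E \<subseteq> F"
  shows "degree V E x \<le> degree V F x"
  using card_mono[OF finite_nbhd nbhd_mono] assms by (metis card_nbhd)

lemma degree_eq_degree_Diff:
  assumes "finite V"
  shows "degree V E x = degree (V - W) E x + card (nbhd V E x \<inter> W)"
proof -
  have "nbhd (V - W) E x = nbhd V E x - W"
    by (auto simp: nbhd_def)
  then show ?thesis
    using card_Int_Diff[OF finite_nbhd[OF assms], of E x W] by (simp flip: card_nbhd)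
qed

lemma bipartite_graphD:
  assumes "bipartite_graph X Y E"
  shows "finite X" "finite Y" "X \<inter> Y = {}"
  using assms by (auto simp: bipartite_graph_def)

lemma bipartite_graph_sym:
  assumes "bipartite_graph X Y E"
  shows "bipartite_graph Y X E"
proof -
  have "{{x, y} | x y. x \<in> X \<and> y \<in> Y} = {{y, x} | y x. y \<in> Y \<and> x \<in> X}"
    by (auto simp: insert_commute)
  with assms show ?thesis
    by (auto simp: bipartite_graph_def Int_commute)
qed

lemma bipartite_graph_edgeE:
  assumes "bipartite_graph X Y E" "e \<in> E"
  obtains x y where "e = {x, y}" "x \<in> X" "y \<in> Y"
  using assms unfolding bipartite_graph_def by blast

lemma bipartite_graph_induced:
  assumes "bipartite_graph X Y E"
  shows "bipartite_graph (X \<inter> S) (Y \<inter> S) (induced_edges E S)"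
  unfolding bipartite_graph_def
proof (intro conjI subsetI)
  fix e assume "e \<in> induced_edges E S"
  then have e: "e \<in> E" "e \<subseteq> S"
    by (auto simp: induced_edges_def)
  obtain x y where "e = {x, y}" "x \<in> X" "y \<in> Y"
    by (rule bipartite_graph_edgeE[OF assms e(1)])
  with e(2) show "e \<in> {{x, y} | x y. x \<in> X \<inter> S \<and> y \<in> Y \<inter> S}"
    by blast
qed (use bipartite_graphD[OF assms] in auto)

lemma bipartite_graph_adj_cases:
  assumes "bipartite_graph X Y E" "adj E a b"
  shows "a \<in> X \<and> b \<in> Y \<or> a \<in> Y \<and> b \<in> X"
  using bipartite_graph_edgeE[OF assms(1) assms(2)[unfolded adj_def]]
  by (metis doubleton_eq_iff)

lemma bipartite_graph_adj_iff:
  assumes "bipartite_graph X Y E" "adj E a b"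
  shows "a \<in> X \<longleftrightarrow> b \<notin> X" "a \<in> Y \<longleftrightarrow> b \<notin> Y"
  using bipartite_graph_adj_cases[OF assms] bipartite_graphD(3)[OF assms(1)] by blast+

lemma bipartite_graph_edges_eqI:
  assumes E: "bipartite_graph X Y E" and F: "bipartite_graph X Y F"
    and adj: "\<And>x y. x \<in> X \<Longrightarrow> y \<in> Y \<Longrightarrow> adj E x y \<longleftrightarrow> adj F x y"
  shows "E = F"
proof -
  have "A \<subseteq> B" if A: "bipartite_graph X Y A"
    and "\<And>x y. x \<in> X \<Longrightarrow> y \<in> Y \<Longrightarrow> adj A x y \<Longrightarrow> adj B x y" for A B
    using that(2) by (metis adj_def bipartite_graph_edgeE[OF A] subsetI)
  from this[OF E] this[OF F] adj show ?thesis
    by blast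
qed

lemma nbhd_bipartite:
  assumes "bipartite_graph X Y E"
  shows "x \<in> X \<Longrightarrow> nbhd (X \<union> Y) E x = {y \<in> Y. adj E x y}"
    and "y \<in> Y \<Longrightarrow> nbhd (X \<union> Y) E y = {x \<in> X. adj E x y}"
  using bipartite_graph_adj_iff[OF assms] bipartite_graphD(3)[OF assms]
  by (auto simp: nbhd_def adj_sym[of E y])

lemma sum_nbhd_swap:
  assumes "bipartite_graph X Y E"
  shows "(\<Sum>x\<in>X. \<Sum>y\<in>nbhd (X \<union> Y) E x. g x y) = (\<Sum>y\<in>Y. \<Sum>x\<in>nbhd (X \<union> Y) E y. g x y)"
  using bipartite_graphD(1,2)[OF assms] sum.swap_restrict[of X Y g "adj E"]
  by (simp add: nbhd_bipartite[OF assms] cong: sum.cong)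

lemma finite_non_adj_pairs: "finite X \<Longrightarrow> finite Y \<Longrightarrow> finite (non_adj_pairs X Y E)"
  by (rule finite_subset[of _ "X \<times> Y"]) (auto simp: non_adj_pairs_def)

lemma non_adj_pairs_mono:
  "X \<subseteq> X' \<Longrightarrow> Y \<subseteq> Y' \<Longrightarrow> F \<subseteq> E \<Longrightarrow> non_adj_pairs X Y E \<subseteq> non_adj_pairs X' Y' F"
  by (auto simp: non_adj_pairs_def adj_def)

lemma card_non_adj_pairs_commute: "card (non_adj_pairs X Y E) = card (non_adj_pairs Y X E)"
proof -
  have "bij_betw prod.swap (non_adj_pairs X Y E) (non_adj_pairs Y X E)"
    by (rule bij_betwI[where g = prod.swap]) (auto simp: non_adj_pairs_def adj_sym)
  then show ?thesis
    by (rule bij_betw_same_card)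
qed

lemma card_adj_pairs_add_non_adj_pairs:
  assumes "finite X" "finite Y"
  shows "card (adj_pairs X Y E) + card (non_adj_pairs X Y E) = card X * card Y"
proof -
  have "X \<times> Y = adj_pairs X Y E \<union> non_adj_pairs X Y E" "adj_pairs X Y E \<inter> non_adj_pairs X Y E = {}"
    by (auto simp: adj_pairs_def non_adj_pairs_def)
  moreover from this have "finite (adj_pairs X Y E)"
    using assms by (metis finite_SigmaI finite_Un)
  ultimately show ?thesis
    using finite_non_adj_pairs[OF assms] by (metis card_Un_disjoint card_cartesian_product)
qed

lemma sum_degree:
  assumes bip: "bipartite_graph X Y E"
  shows "(\<Sum>x\<in>X. degree (X \<union> Y) E x) = card (adj_pairs X Y E)"
    and "(\<Sum>y\<in>Y. degree (X \<union> Y) E y) = card (adj_pairs X Y E)"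
proof -
  have "adj_pairs X Y E = (SIGMA x:X. nbhd (X \<union> Y) E x)"
    by (auto simp: adj_pairs_def nbhd_bipartite[OF bip])
  then show X: "(\<Sum>x\<in>X. degree (X \<union> Y) E x) = card (adj_pairs X Y E)"
    using bipartite_graphD[OF bip] by (simp add: card_SigmaI finite_nbhd card_nbhd)
  show "(\<Sum>y\<in>Y. degree (X \<union> Y) E y) = card (adj_pairs X Y E)"
    using sum_nbhd_swap[OF bip, of "\<lambda>_ _. 1 :: nat"] X by (simp add: card_nbhd)
qed

section \<open>Hamiltonian paths in bipartite graphs\<close>

lemma ham_path_altdef:
  "ham_path E S u v ps \<longleftrightarrow>
     ps \<noteq> [] \<and> distinct ps \<and> set ps = S \<and> hd ps = u \<and> last ps = v \<and> successively (adj E) ps"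
  by (simp add: ham_path_def successively_conv_nth)

lemma ham_path_rev: "ham_path E S u v ps \<Longrightarrow> ham_path E S v u (rev ps)"
  by (simp add: ham_path_altdef hd_rev last_rev adj_sym)

lemma ham_path_induced_edges:
  assumes "S \<subseteq> T"
  shows "ham_path (induced_edges E T) S u v ps \<longleftrightarrow> ham_path E S u v ps"
  using assms by (auto simp: ham_path_def adj_induced_edges subset_iff)

lemma ham_path_alternates:
  assumes bip: "bipartite_graph X Y E" and ps: "ham_path E (X \<union> Y) u v ps" and u: "u \<in> X"
  shows "i < length ps \<Longrightarrow> ps ! i \<in> X \<longleftrightarrow> even i"
proof (induction i)
  case 0
  then show ?case
    using ps u by (auto simp: ham_path_altdef hd_conv_nth)
next
  case (Suc i)
  then have "adj E (ps ! i) (ps ! Suc i)"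
    using ps by (simp add: ham_path_def)
  with Suc show ?case
    using bipartite_graph_adj_iff(1)[OF bip] by auto
qed

text \<open>The 2-opt move: reverse the segment between the two deleted edges.\<close>

lemma ham_path_two_opt:
  assumes ps: "distinct ps" "set ps = S" "hd ps = u" "last ps = v"
    and adj: "\<And>l. Suc l < length ps \<Longrightarrow> l \<noteq> p \<Longrightarrow> l \<noteq> q \<Longrightarrow> adj E (ps ! l) (ps ! Suc l)"
    and pq: "p < q" "Suc q < length ps"
    and new: "adj E (ps ! p) (ps ! q)" "adj E (ps ! Suc p) (ps ! Suc q)"
  shows "\<exists>ps'. ham_path E S u v ps'"
proof
  define as bs cs where "as = take (Suc p) ps" and "bs = take (q - p) (drop (Suc p) ps)"
    and "cs = drop (Suc q) ps"
  have "drop (Suc p) ps = bs @ drop (q - p) (drop (Suc p) ps)"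
    unfolding bs_def by (rule append_take_drop_id[symmetric])
  also have "drop (q - p) (drop (Suc p) ps) = cs"
    using pq by (simp add: cs_def)
  finally have split: "ps = as @ bs @ cs"
    unfolding as_def by (metis append_take_drop_id)
  have len: "length as = Suc p" "length bs = q - p" "length cs = length ps - Suc q"
    using pq by (auto simp: as_def bs_def cs_def)
  have ne: "as \<noteq> []" "bs \<noteq> []" "cs \<noteq> []"
    using len pq by auto
  have ends: "last as = ps ! p" "hd bs = ps ! Suc p" "last bs = ps ! q" "hd cs = ps ! Suc q"
    using pq ne by (auto simp: as_def bs_def cs_def last_conv_nth hd_conv_nth min_def)
  have "successively (adj E) as" "successively (adj E) bs" "successively (adj E) cs"
    using pq adj by (auto simp: as_def bs_def cs_def successively_conv_nth)
  then have "successively (adj E) (as @ rev bs @ cs)"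
    using new ne ends by (simp add: successively_append_iff hd_rev last_rev adj_sym)
  moreover have "distinct (as @ rev bs @ cs)" "set (as @ rev bs @ cs) = S"
    using ps split by auto
  moreover have "hd (as @ rev bs @ cs) = u" "last (as @ rev bs @ cs) = v"
    using ps ne split by auto
  ultimately show "ham_path E S u v (as @ rev bs @ cs)"
    using ne by (simp add: ham_path_altdef)
qed

lemma card_parity_below:
  "card {j. Suc j < 2 * m \<and> odd j} = m - 1" "card {j. Suc j < 2 * m \<and> even j} = m"
proof -
  have "bij_betw (\<lambda>l. 2 * l + 1) {..<m - 1} {j. Suc j < 2 * m \<and> odd j}"
    by (rule bij_betwI[where g = "\<lambda>j. j div 2"]) (auto elim!: oddE)
  from bij_betw_same_card[OF this] show "card {j. Suc j < 2 * m \<and> odd j} = m - 1"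
    by simp
  have "bij_betw (\<lambda>l. 2 * l) {..<m} {j. Suc j < 2 * m \<and> even j}"
    by (rule bij_betwI[where g = "\<lambda>j. j div 2"]) (auto elim!: evenE)
  from bij_betw_same_card[OF this] show "card {j. Suc j < 2 * m \<and> even j} = m"
    by simp
qed

lemma degree_set_list:
  assumes "distinct ps"
  shows "degree (set ps) E w = card {j. j < length ps \<and> adj E w (ps ! j)}"
proof -
  have "{y \<in> set ps. adj E w y} = (!) ps ` {j. j < length ps \<and> adj E w (ps ! j)}"
    by (auto simp: in_set_conv_nth)
  moreover have "inj_on ((!) ps) {j. j < length ps \<and> adj E w (ps ! j)}"
    using assms by (auto simp: inj_on_def nth_eq_iff_index_eq)
  ultimately show ?thesis
    by (simp add: degree_def card_image)
qed

lemma degree_insert: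
  assumes "finite V" "z \<notin> V"
  shows "degree (insert z V) E w = degree V E w + of_bool (adj E w z)"
proof -
  have "{y \<in> insert z V. adj E w y} = (if adj E w z then insert z else id) {y \<in> V. adj E w y}"
    by auto
  then show ?thesis
    using assms by (simp add: degree_def)
qed

lemma degree_set_list_last:
  assumes "distinct ps" "ps \<noteq> []"
  shows "degree (set ps) E w = card {j. Suc j < length ps \<and> adj E w (ps ! j)} +
    of_bool (adj E w (last ps))"
proof (cases ps rule: rev_cases)
  case (snoc qs z)
  have "{j. Suc j < length ps \<and> adj E w (ps ! j)} = {j. j < length qs \<and> adj E w (qs ! j)}"
    by (auto simp: snoc nth_append)
  then show ?thesis
    using assms(1) degree_set_list[of qs E w] by (simp add: snoc degree_insert)
qed (use assms in simp)

lemma degree_set_list_hd: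
  assumes "distinct ps" "ps \<noteq> []"
  shows "degree (set ps) E w = card {j. Suc j < length ps \<and> adj E w (ps ! Suc j)} +
    of_bool (adj E w (hd ps))"
proof (cases ps)
  case (Cons z qs)
  then show ?thesis
    using assms(1) degree_set_list[of qs E w] by (simp add: degree_insert)
qed (use assms in simp)

text \<open>If only the edge at position i is missing from a would-be path, then for no j can both 2-opt
  edges be present; so the neighbours of its two ends sit at complementary positions.\<close>

lemma card_broken_edge_positions:
  assumes bip: "bipartite_graph X Y E"
    and ps: "distinct ps" "set ps = X \<union> Y" "hd ps = u" "last ps = v" "length ps = 2 * m"
    and alt: "\<And>j. j < 2 * m \<Longrightarrow> ps ! j \<in> X \<longleftrightarrow> even j"
    and adj: "\<And>l. Suc l < 2 * m \<Longrightarrow> l \<noteq> i \<Longrightarrow> adj E (ps ! l) (ps ! Suc l)" and i: "Suc i < 2 * m"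
    and no: "\<nexists>ps. ham_path E (X \<union> Y) u v ps"
  shows "card {j. Suc j < 2 * m \<and> adj E (ps ! i) (ps ! j)} +
    card {j. Suc j < 2 * m \<and> adj E (ps ! Suc i) (ps ! Suc j)} \<le> (if even i then m - 1 else m)"
    (is "card ?A + card ?B \<le> _")
proof -
  note two_opt = ham_path_two_opt[OF ps(1-4), of _ _ E, unfolded ps(5)]
  have par: "odd (k + j)" if "adj E (ps ! k) (ps ! j)" "k < 2 * m" "j < 2 * m" for k j
    using bipartite_graph_adj_iff(1)[OF bip that(1)] alt that by auto
  have "?A \<inter> ?B = {}"
  proof (rule ccontr)
    assume "?A \<inter> ?B \<noteq> {}"
    then obtain j where j: "Suc j < 2 * m" "adj E (ps ! i) (ps ! j)" "adj E (ps ! Suc i) (ps ! Suc j)"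
      by blast
    have "i \<noteq> j"
      using par[OF j(2)] i by auto
    then consider "i < j" | "j < i"
      by linarith
    then show False
    proof cases
      case 1
      from two_opt[OF adj 1 j] no show False by blast
    next
      case 2
      from two_opt[OF adj 2 i j(2,3)[THEN adj_sym[THEN iffD1]]] no show False by blast
    qed
  qed
  moreover have "finite ?A" "finite ?B"
    by (rule finite_subset[of _ "{..<2 * m}"]; auto)+
  ultimately have "card ?A + card ?B = card (?A \<union> ?B)"
    by (simp add: card_Un_disjoint)
  also have "\<dots> \<le> card {j. Suc j < 2 * m \<and> odd (i + j)}"
  proof (rule card_mono)
    show "finite {j. Suc j < 2 * m \<and> odd (i + j)}"
      by (rule finite_subset[of _ "{..<2 * m}"]) auto
    show "?A \<union> ?B \<subseteq> {j. Suc j < 2 * m \<and> odd (i + j)}"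
      using par[of i] par[of "Suc i" "Suc _"] i by auto
  qed
  also have "\<dots> = (if even i then m - 1 else m)"
    using card_parity_below[of m] by simp
  finally show ?thesis .
qed

lemma ham_path_insert_edgeE:
  assumes "ham_path (insert {x, y} E) S u v ps" "\<not> ham_path E S u v ps"
  obtains i where "Suc i < length ps" "{ps ! i, ps ! Suc i} = {x, y}"
    "\<And>l. Suc l < length ps \<Longrightarrow> l \<noteq> i \<Longrightarrow> adj E (ps ! l) (ps ! Suc l)"
proof -
  have dist: "distinct ps"
    using assms(1) by (simp add: ham_path_def)
  have step: "adj E (ps ! l) (ps ! Suc l) \<or> {ps ! l, ps ! Suc l} = {x, y}" if "Suc l < length ps" for l
    using assms(1) that by (auto simp: ham_path_def adj_def)
  obtain i where i: "Suc i < length ps" "\<not> adj E (ps ! i) (ps ! Suc i)"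
    using assms unfolding ham_path_def by metis
  show thesis
  proof (rule that[OF i(1)])
    show edge_i: "{ps ! i, ps ! Suc i} = {x, y}"
      using step i by blast
    fix l assume l: "Suc l < length ps" "l \<noteq> i"
    then have "{ps ! l, ps ! Suc l} \<noteq> {ps ! i, ps ! Suc i}"
      using i(1) dist by (auto simp: doubleton_eq_iff nth_eq_iff_index_eq)
    with step[OF l(1)] edge_i show "adj E (ps ! l) (ps ! Suc l)"
      by simp
  qed
qed

text \<open>The analogue of the Bondy--Chvatal closure for paths with prescribed ends.\<close>

lemma degree_sum_le_if_edge_creates_ham_path:
  assumes bip: "bipartite_graph X Y E" and card: "card X = m" "card Y = m"
    and xy: "x \<in> X" "y \<in> Y" and uv: "u \<in> X" "v \<in> Y"
    and no: "\<nexists>ps. ham_path E (X \<union> Y) u v ps"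
    and ex: "\<exists>ps. ham_path (insert {x, y} E) (X \<union> Y) u v ps"
  shows "degree (X \<union> Y) E x + degree (X \<union> Y) E y \<le> m + 1 \<and>
    (degree (X \<union> Y) E x + degree (X \<union> Y) E y = m + 1 \<longrightarrow> adj E x v \<and> adj E u y)"
proof -
  let ?d = "degree (X \<union> Y) E" and ?F = "insert {x, y} E"
  have bip_F: "bipartite_graph X Y ?F"
    using bip xy by (auto simp: bipartite_graph_def)
  obtain ps where hp: "ham_path ?F (X \<union> Y) u v ps"
    using ex by blast
  then have ps: "distinct ps" "set ps = X \<union> Y" "hd ps = u" "last ps = v" and ne: "ps \<noteq> []"
    by (auto simp: ham_path_def)
  have len: "length ps = 2 * m"
    using distinct_card[OF ps(1)] ps(2) card bipartite_graphD[OF bip] by (simp add: card_Un_disjoint)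
  have m: "m > 0"
    using ne len by (cases m) auto
  note alt = ham_path_alternates[OF bip_F hp uv(1), unfolded len]
  obtain i where i: "Suc i < 2 * m" "{ps ! i, ps ! Suc i} = {x, y}"
    and adj: "\<And>l. Suc l < 2 * m \<Longrightarrow> l \<noteq> i \<Longrightarrow> adj E (ps ! l) (ps ! Suc l)"
    using ham_path_insert_edgeE[OF hp] no len by metis
  note bound = card_broken_edge_positions[OF bip ps len alt adj i(1) no]
  have deg: "?d (ps ! i) =
      card {j. Suc j < 2 * m \<and> adj E (ps ! i) (ps ! j)} + of_bool (adj E (ps ! i) v)"
    "?d (ps ! Suc i) =
      card {j. Suc j < 2 * m \<and> adj E (ps ! Suc i) (ps ! Suc j)} + of_bool (adj E (ps ! Suc i) u)"
    using degree_set_list_last[OF ps(1) ne] degree_set_list_hd[OF ps(1) ne] by (simp_all add: ps len)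
  show ?thesis
  proof (cases "even i")
    case True
    then have "ps ! i = x" "ps ! Suc i = y"
      using alt[of i] i xy bipartite_graphD(3)[OF bip] by (auto simp: doubleton_eq_iff)
    then show ?thesis
      using deg bound True m adj_sym[of E u y] by (auto split: if_splits)
  next
    case False
    then have "ps ! i = y" "ps ! Suc i = x"
      using alt[of i] i xy bipartite_graphD(3)[OF bip] by (auto simp: doubleton_eq_iff)
    moreover have "\<not> adj E y v" "\<not> adj E x u"
      using bipartite_graph_adj_iff[OF bip] xy uv by blast+
    ultimately show ?thesis
      using deg bound False by auto
  qed
qed

definition zigzag :: "'a set set \<Rightarrow> 'a set \<Rightarrow> 'a set \<Rightarrow> 'a list \<Rightarrow> bool" where
  "zigzag E A B zs \<longleftrightarrow> distinct zs \<and> set zs = A \<union> B \<and> successively (adj E) zs \<and>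
     (zs \<noteq> [] \<longrightarrow> hd zs \<in> B \<and> last zs \<in> A)"

lemma ex_zigzag_if_complete:
  assumes "finite A" "finite B" "card A = card B" "A \<inter> B = {}"
    and "\<And>a b. a \<in> A \<Longrightarrow> b \<in> B \<Longrightarrow> adj E a b"
  shows "\<exists>zs. zigzag E A B zs"
  using assms
proof (induction A arbitrary: B rule: finite_induct)
  case empty
  then show ?case
    by (intro exI[of _ "[]"]) (simp add: zigzag_def)
next
  case (insert a A)
  then obtain b where b: "b \<in> B"
    by fastforce
  have "\<exists>zs. zigzag E A (B - {b}) zs"
    using insert.prems insert.hyps b by (intro insert.IH) auto
  then obtain zs where zs: "distinct zs" "set zs = A \<union> (B - {b})" "successively (adj E) zs"
    "zs \<noteq> [] \<Longrightarrow> hd zs \<in> B - {b} \<and> last zs \<in> A"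
    by (auto simp: zigzag_def)
  have "adj E b a" "zs \<noteq> [] \<Longrightarrow> adj E a (hd zs)"
    using insert.prems(4) b zs(4) adj_sym[of E b a] by auto
  then have "successively (adj E) (b # a # zs)"
    using zs(3) by (cases zs) auto
  moreover have "distinct (b # a # zs)" "set (b # a # zs) = insert a A \<union> B"
    using zs(1,2) b insert.hyps insert.prems(3) by auto
  ultimately show ?case
    using b zs(4) by (intro exI[of _ "b # a # zs"]) (auto simp: zigzag_def)
qed

lemma ham_path_join:
  assumes fin: "finite X" "finite Y" "X \<inter> Y = {}"
    and pre: "pre \<noteq> []" "hd pre = u" "successively (adj E) pre"
    and suf: "suf \<noteq> []" "last suf = v" "successively (adj E) suf"
    and dist: "distinct (pre @ suf)" "set (pre @ suf) \<subseteq> X \<union> Y"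
    and card: "card (X - set (pre @ suf)) = card (Y - set (pre @ suf))"
    and complete: "\<And>x y. x \<in> insert (last pre) (X - set (pre @ suf)) \<Longrightarrow>
      y \<in> insert (hd suf) (Y - set (pre @ suf)) \<Longrightarrow> adj E x y"
  shows "\<exists>ps. ham_path E (X \<union> Y) u v ps"
proof -
  have "\<exists>zs. zigzag E (X - set (pre @ suf)) (Y - set (pre @ suf)) zs"
    by (rule ex_zigzag_if_complete[OF _ _ card]) (use fin complete in auto)
  then obtain zs where zs: "distinct zs" "set zs = (X - set (pre @ suf)) \<union> (Y - set (pre @ suf))"
    "successively (adj E) zs"
    "zs \<noteq> [] \<Longrightarrow> hd zs \<in> Y - set (pre @ suf) \<and> last zs \<in> X - set (pre @ suf)"
    unfolding zigzag_def by blast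
  have "successively (adj E) (pre @ zs @ suf)"
    using pre suf zs(3,4) complete by (cases "zs = []") (auto simp: successively_append_iff)
  moreover have "distinct (pre @ zs @ suf)" "set (pre @ zs @ suf) = X \<union> Y"
    using dist zs(1,2) by auto
  ultimately have "ham_path E (X \<union> Y) u v (pre @ zs @ suf)"
    using pre suf by (simp add: ham_path_altdef)
  then show ?thesis ..
qed

section \<open>Low-degree vertices of closed graphs\<close>

definition low_degree_structure :: "'a set \<Rightarrow> 'a set \<Rightarrow> 'a set set \<Rightarrow> nat \<Rightarrow> nat \<Rightarrow> bool" where
  "low_degree_structure X Y E t s \<longleftrightarrow>
     (\<exists>T. (T \<subseteq> X \<or> T \<subseteq> Y) \<and> card T = t \<and> (\<forall>x\<in>T. degree (X \<union> Y) E x \<le> s)) \<or>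
     (t = 2 \<and> (\<exists>x\<in>X. \<exists>y\<in>Y. adj E x y \<and> degree (X \<union> Y) E x \<le> s \<and> degree (X \<union> Y) E y \<le> s))"

lemma low_degree_structure_commute:
  "low_degree_structure X Y E t s \<longleftrightarrow> low_degree_structure Y X E t s"
  unfolding low_degree_structure_def using adj_sym[of E] by (simp add: Un_commute) blast

lemma mult_ge_of_both_ge:
  fixes x y s :: nat
  assumes "s \<le> x" "s \<le> y"
  shows "s * (x + y) \<le> x * y + s * s"
proof -
  obtain i j where "x = s + i" "y = s + j"
    using assms le_Suc_ex by metis
  then show ?thesis
    by (simp add: algebra_simps)
qed

lemma max_pair_degree_cases:
  fixes a b m t :: nat
  assumes "t \<le> b" "b \<le> a" "a \<le> m" "a + b \<le> m + 1"
    and few: "(m - a) * (m - b) < (t + 1) * (m - t - 2)"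
  shows "b = t \<and> a = m - t \<or> a + b = m + 1 \<and> (b = t \<or> b = t + 1)"
proof -
  have "m - a \<le> t"
  proof (rule ccontr)
    assume "\<not> m - a \<le> t"
    then have "(t + 1) * (m - a + (m - b)) \<le> (m - a) * (m - b) + (t + 1) * (t + 1)"
      using assms by (intro mult_ge_of_both_ge) auto
    moreover have "(t + 1) * ((m - t - 2) + (t + 1)) \<le> (t + 1) * (m - a + (m - b))"
      using assms \<open>\<not> m - a \<le> t\<close> by (intro mult_le_mono2) linarith
    ultimately show False
      using few by (simp only: add_mult_distrib2)
  qed
  then show ?thesis
    using assms by linarith
qed

lemma second_pair_degree_cases:
  fixes a b m t r :: nat
  assumes "2 \<le> t" "t + 2 < m" "t \<le> a" "1 \<le> r" "b \<le> m" "a + b \<le> m + 1" "m \<le> a + (t - 1) + r"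
    and few: "(t - 1) * (m - t) + r * (m - b) < (t + 1) * (m - t - 2)"
  shows "r = 1 \<or> t = 2 \<and> a = 2"
proof (rule ccontr)
  assume "\<not> ?thesis"
  then have "2 \<le> r" "2 \<le> m - b"
    using assms(1-7) by linarith+
  then have "2 * (r + (m - b)) \<le> r * (m - b) + 2 * 2"
    by (rule mult_ge_of_both_ge)
  moreover have "2 * (m - t) \<le> 2 * (r + (m - b))"
    using assms(1-7) by (intro mult_le_mono2) linarith
  ultimately have "2 * (m - t) \<le> r * (m - b) + 2 * 2"
    by (rule le_trans[rotated])
  moreover obtain t' s where "t = Suc t'" "m = t + 2 + s"
    using assms(1,2) by (metis Suc_le_D add_2_eq_Suc less_imp_le le_Suc_ex numeral_2_eq_2)
  ultimately show False
    using few by (simp add: algebra_simps)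
qed

text \<open>The edge-maximal graph obtained from G - W, where m = n - p and t = k - p.\<close>

locale closed_bigraph =
  fixes X Y :: "'a set" and E :: "'a set set" and u v :: 'a and m t :: nat
  assumes bip: "bipartite_graph X Y E"
    and card_X: "card X = m" and card_Y: "card Y = m"
    and u: "u \<in> X" and v: "v \<in> Y"
    and min_degree: "\<And>x. x \<in> X \<union> Y \<Longrightarrow> t \<le> degree (X \<union> Y) E x"
    and t_pos: "1 \<le> t"
    and few_missing: "card (non_adj_pairs X Y E) < (t + 1) * (m - t - 2)"
    and no_path: "\<nexists>ps. ham_path E (X \<union> Y) u v ps"
    and closed: "\<And>x y. x \<in> X \<Longrightarrow> y \<in> Y \<Longrightarrow> \<not> adj E x y \<Longrightarrow>
      degree (X \<union> Y) E x + degree (X \<union> Y) E y \<le> m + 1"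
    and closed_eq: "\<And>x y. x \<in> X \<Longrightarrow> y \<in> Y \<Longrightarrow> \<not> adj E x y \<Longrightarrow>
      degree (X \<union> Y) E x + degree (X \<union> Y) E y = m + 1 \<Longrightarrow> adj E x v \<and> adj E u y"
begin

abbreviation d :: "'a \<Rightarrow> nat" where "d \<equiv> degree (X \<union> Y) E"
abbreviation N :: "'a \<Rightarrow> 'a set" where "N \<equiv> nbhd (X \<union> Y) E"
abbreviation missing :: "('a \<times> 'a) set" where "missing \<equiv> non_adj_pairs X Y E"

lemma closed_bigraph_swap: "closed_bigraph Y X E v u m t"
proof
  show "bipartite_graph Y X E"
    by (rule bipartite_graph_sym[OF bip])
  show "card (non_adj_pairs Y X E) < (t + 1) * (m - t - 2)"
    using few_missing by (simp add: card_non_adj_pairs_commute[of Y])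
  show "\<nexists>ps. ham_path E (Y \<union> X) v u ps"
    using no_path ham_path_rev by (metis Un_commute)
  fix x y assume xy: "x \<in> Y" "y \<in> X" "\<not> adj E x y"
  then have yx: "\<not> adj E y x"
    by (simp add: adj_sym)
  show "degree (Y \<union> X) E x + degree (Y \<union> X) E y \<le> m + 1"
    using closed[OF xy(2,1) yx] by (simp add: add.commute Un_commute)
  show "adj E x u \<and> adj E v y" if "degree (Y \<union> X) E x + degree (Y \<union> X) E y = m + 1"
    using closed_eq[OF xy(2,1) yx] that by (simp add: add.commute Un_commute adj_sym)
qed (use card_X card_Y u v min_degree t_pos in \<open>auto simp: Un_commute\<close>)

lemma finite_X [simp]: "finite X" and finite_Y [simp]: "finite Y" and disjoint: "X \<inter> Y = {}"
  using bipartite_graphD[OF bip] by auto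

lemma finite_N [simp]: "finite (N x)"
  by (simp add: finite_nbhd)

lemma N_X: "x \<in> X \<Longrightarrow> N x = {y \<in> Y. adj E x y}" and N_Y: "y \<in> Y \<Longrightarrow> N y = {x \<in> X. adj E x y}"
  by (simp_all add: nbhd_bipartite[OF bip])

lemma card_Diff_N:
  shows "x \<in> X \<Longrightarrow> card (Y - N x) = m - d x" and "y \<in> Y \<Longrightarrow> card (X - N y) = m - d y"
  by (auto simp: card_Diff_subset N_X N_Y card_X card_Y simp flip: card_nbhd)

lemma d_le: "x \<in> X \<union> Y \<Longrightarrow> d x \<le> m"
  using card_mono[of Y "N x"] card_mono[of X "N x"]
  by (auto simp: N_X N_Y card_X card_Y simp flip: card_nbhd)

lemma m_gt: "t + 2 < m"
  using few_missing by (cases "m - t - 2") auto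

lemma finite_missing [simp]: "finite missing"
  by (simp add: finite_non_adj_pairs)

lemma card_missing_row: "x \<in> X \<Longrightarrow> card (missing \<inter> {x} \<times> Y) = m - d x"
proof -
  assume x: "x \<in> X"
  then have "missing \<inter> {x} \<times> Y = {x} \<times> (Y - N x)"
    by (auto simp: non_adj_pairs_def N_X)
  then show ?thesis
    using x by (simp add: card_cartesian_product card_Diff_N)
qed

lemma card_missing_column: "y \<in> Y \<Longrightarrow> card (missing \<inter> X \<times> {y}) = m - d y"
proof -
  assume y: "y \<in> Y"
  then have "missing \<inter> X \<times> {y} = (X - N y) \<times> {y}"
    by (auto simp: non_adj_pairs_def N_Y)
  then show ?thesis
    using y by (simp add: card_cartesian_product card_Diff_N)
qed

lemma card_missing_columns_ge:
  assumes B: "B \<subseteq> Y" "\<And>y. y \<in> B \<Longrightarrow> d y \<le> s"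
  shows "card B * (m - s) \<le> card (missing \<inter> X \<times> B)"
proof -
  have "finite B"
    using B(1) by (rule finite_subset) simp
  have "card B * (m - s) \<le> (\<Sum>y\<in>B. m - d y)"
    using sum_bounded_below[of B "m - s" "\<lambda>y. m - d y"] B(2) by (simp add: diff_le_mono2)
  also have "\<dots> = (\<Sum>y\<in>B. card (missing \<inter> X \<times> {y}))"
    using B(1) by (intro sum.cong) (auto simp: card_missing_column)
  also have "\<dots> = card (\<Union>y\<in>B. missing \<inter> X \<times> {y})"
    using \<open>finite B\<close> by (intro card_UN_disjoint[symmetric]) auto
  also have "(\<Union>y\<in>B. missing \<inter> X \<times> {y}) = missing \<inter> X \<times> B"
    by auto
  finally show ?thesis .
qed

abbreviation cross :: "'a \<Rightarrow> 'a \<Rightarrow> ('a \<times> 'a) set" where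
  "cross x y \<equiv> missing \<inter> {x} \<times> Y \<union> missing \<inter> X \<times> {y}"

lemma card_cross_ge:
  assumes "x \<in> X" "y \<in> Y" "\<not> adj E x y"
  shows "m \<le> card (cross x y) + 2"
proof -
  have "(missing \<inter> {x} \<times> Y) \<inter> (missing \<inter> X \<times> {y}) = {(x, y)}"
    using assms by (auto simp: non_adj_pairs_def)
  then have "m - d x + (m - d y) = card (cross x y) + 1"
    using card_Un_Int[of "missing \<inter> {x} \<times> Y" "missing \<inter> X \<times> {y}"] assms
    by (simp add: card_missing_row card_missing_column)
  moreover have "d x + d y \<le> m + 1"
    using assms by (rule closed)
  ultimately show ?thesis
    by linarith
qed

lemma card_missing_ge_columns_cross:
  assumes B: "B \<subseteq> Y" "\<And>y. y \<in> B \<Longrightarrow> d y \<le> s"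
    and xy: "x \<in> X" "y \<in> Y - B" "\<not> adj E x y"
  shows "card B * (m - s) + m \<le> card missing + card B + 2"
proof -
  let ?C = "missing \<inter> X \<times> B"
  have "?C \<inter> cross x y \<subseteq> {x} \<times> B"
    using xy by auto
  moreover have "finite ({x} \<times> B)"
    using finite_subset[OF B(1)] by simp
  ultimately have "card (?C \<inter> cross x y) \<le> card ({x} \<times> B)"
    by (rule card_mono[rotated])
  moreover have "card ?C + card (cross x y) = card (?C \<union> cross x y) + card (?C \<inter> cross x y)"
    by (rule card_Un_Int) auto
  moreover have "card (?C \<union> cross x y) \<le> card missing"
    by (rule card_mono) auto
  moreover have "card B * (m - s) \<le> card ?C"
    using B by (rule card_missing_columns_ge)
  moreover have "m \<le> card (cross x y) + 2"
    using xy by (intro card_cross_ge) auto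
  ultimately show ?thesis
    by (simp add: card_cartesian_product)
qed

lemma card_missing_ge_two_crosses:
  assumes "x0 \<in> X" "y0 \<in> Y" and xy: "x1 \<in> X - {x0}" "y1 \<in> Y - {y0}" "\<not> adj E x1 y1"
  shows "(m - d x0) + (m - d y0) + m \<le> card missing + 5"
proof -
  let ?R = "missing \<inter> {x0} \<times> Y" and ?C = "missing \<inter> X \<times> {y0}"
  have "?R \<inter> ?C \<subseteq> {(x0, y0)}" "cross x0 y0 \<inter> cross x1 y1 \<subseteq> {(x0, y1), (x1, y0)}"
    using xy by auto
  then have "card (?R \<inter> ?C) \<le> card {(x0, y0)}"
    "card (cross x0 y0 \<inter> cross x1 y1) \<le> card {(x0, y1), (x1, y0)}"
    by (intro card_mono; simp)+
  moreover have "card ?R + card ?C = card (cross x0 y0) + card (?R \<inter> ?C)"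
    by (rule card_Un_Int) auto
  moreover have "card (cross x0 y0) + card (cross x1 y1) =
      card (cross x0 y0 \<union> cross x1 y1) + card (cross x0 y0 \<inter> cross x1 y1)"
    by (rule card_Un_Int) auto
  moreover have "card (cross x0 y0 \<union> cross x1 y1) \<le> card missing"
    by (rule card_mono) auto
  moreover have "m \<le> card (cross x1 y1) + 2"
    using xy by (intro card_cross_ge) auto
  moreover have "card {(x0, y1), (x1, y0)} \<le> 2"
    by (simp add: card_insert_if)
  ultimately show ?thesis
    using assms(1,2) card_missing_row card_missing_column by simp
qed

definition saturated_pair :: "'a \<Rightarrow> 'a \<Rightarrow> bool" where
  "saturated_pair x y \<longleftrightarrow> x \<in> X \<and> y \<in> Y \<and> \<not> adj E x y \<and> d x + d y = m + 1"

definition common_nbhd :: "'a \<Rightarrow> bool" where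
  "common_nbhd x \<longleftrightarrow> (\<forall>x'\<in>X. N x \<subseteq> N x')"

lemma saturated_pairD:
  assumes "saturated_pair x y"
  shows "x \<in> X" "y \<in> Y" "\<not> adj E x y" "d x + d y = m + 1" "y \<in> Y - N x"
  using assms by (auto simp: saturated_pair_def in_nbhd)

lemma saturated_pair_ends:
  assumes "saturated_pair x y"
  shows "v \<in> N x" "u \<in> N y"
  using closed_eq[of x y] u v assms by (auto simp: saturated_pair_def N_X N_Y)

lemma card_saturated_pair_non_nbhd:
  assumes "saturated_pair x y"
  shows "card (Y - N x) = d y - 1"
  using saturated_pairD[OF assms] d_le[of y] by (simp add: card_Diff_N)

lemma saturated_pair_degree_le:
  assumes "saturated_pair x y" "z \<in> Y - N x"
  shows "d z \<le> d y"
  using closed[of x z] saturated_pairD[OF assms(1)] assms(2) by (auto simp: N_X)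

lemma saturated_pair_N_subset:
  assumes sat: "saturated_pair x y" and common: "common_nbhd x" and z: "z \<in> Y - N x"
  shows "N z \<subseteq> N y"
proof
  fix w assume w: "w \<in> N z"
  note xy = saturated_pairD[OF sat]
  show "w \<in> N y"
  proof (rule ccontr)
    assume "w \<notin> N y"
    then have "w \<in> X" "adj E w z" "\<not> adj E w y"
      using w z xy(2) by (auto simp: N_Y)
    then have "card (N w) \<le> card (N x)"
      using closed[of w y] xy by (simp add: card_nbhd)
    then have "N x = N w"
      using common \<open>w \<in> X\<close> by (intro card_seteq) (auto simp: common_nbhd_def)
    then show False
      using z \<open>w \<in> X\<close> \<open>adj E w z\<close> by (auto simp: N_X)
  qed
qed

lemma saturated_pair_path:
  assumes sat: "saturated_pair x y"
    and a: "a \<in> N y - {u}" "\<And>z. z \<in> Y - N x - {y} \<Longrightarrow> N y - {a} \<subseteq> N z"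
  obtains pre where "distinct pre" "set pre = N y \<union> (Y - N x)" "successively (adj E) pre"
    "pre \<noteq> []" "hd pre = u" "last pre = a"
proof -
  define L where "L = Y - N x"
  note xy = saturated_pairD[OF sat] and u_y = saturated_pair_ends(2)[OF sat]
  have L: "L \<subseteq> Y" "y \<in> L" "card L = d y - 1"
    using xy(5) card_saturated_pair_non_nbhd[OF sat] by (auto simp: L_def)
  have "card (N y - {u, a}) = card (L - {y})"
    using u_y a(1) L by (auto simp: card_Diff_subset card_nbhd card_insert_if)
  then have "\<exists>zs. zigzag E (N y - {u, a}) (L - {y}) zs"
    using L xy(2) a(2) disjoint by (intro ex_zigzag_if_complete) (auto simp: L_def N_Y subset_iff)
  then obtain zs where zs: "distinct zs" "set zs = (N y - {u, a}) \<union> (L - {y})" "successively (adj E) zs"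
    "zs \<noteq> [] \<Longrightarrow> hd zs \<in> L - {y} \<and> last zs \<in> N y - {u, a}"
    unfolding zigzag_def by blast
  have "u \<in> N (hd zs)" "last zs \<in> N y" if "zs \<noteq> []"
    using zs(4)[OF that] a u_y by (auto simp: L_def)
  then have "adj E u (hd zs)" "adj E (last zs) y" if "zs \<noteq> []"
    using that by (auto simp: in_nbhd adj_sym)
  moreover have "adj E u y" "adj E y a"
    using u_y a(1) xy(2) by (auto simp: N_Y adj_sym)
  ultimately have "successively (adj E) (u # zs @ [y, a])"
    using zs(3) by (cases "zs = []") (auto simp: successively_append_iff successively_Cons)
  moreover have "distinct (u # zs @ [y, a])"
    using zs(1,2) a(1) u u_y xy(2) L(1) disjoint by (auto simp: N_Y)
  moreover have "set (u # zs @ [y, a]) = N y \<union> (Y - N x)"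
    using zs(2) u_y a(1) L(2) by (auto simp: L_def)
  ultimately show thesis
    using that[of "u # zs @ [y, a]"] by simp
qed

lemma no_saturated_pair_with_common_nbhd:
  assumes sat: "saturated_pair x y" and common: "common_nbhd x"
    and a: "a \<in> N y - {u}" "\<And>z. z \<in> Y - N x - {y} \<Longrightarrow> N y - {a} \<subseteq> N z"
  shows False
proof -
  note xy = saturated_pairD[OF sat]
  obtain pre where pre: "distinct pre" "set pre = N y \<union> (Y - N x)" "successively (adj E) pre"
    "pre \<noteq> []" "hd pre = u" "last pre = a"
    by (rule saturated_pair_path[OF sat a])
  have v: "v \<in> Y" "v \<in> N x" and N: "N x \<subseteq> Y" "N y \<subseteq> X"
    using saturated_pair_ends[OF sat] v xy(1,2) by (auto simp: N_X N_Y)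
  have rest: "X - set (pre @ [v]) = X - N y" "Y - set (pre @ [v]) = N x - {v}"
    using pre(2) N v disjoint by auto
  have "\<exists>ps. ham_path E (X \<union> Y) u v ps"
  proof (rule ham_path_join[OF finite_X finite_Y disjoint pre(4,5,3)])
    show "distinct (pre @ [v])" "set (pre @ [v]) \<subseteq> X \<union> Y"
      using pre(1,2) v N disjoint by auto
    show "card (X - set (pre @ [v])) = card (Y - set (pre @ [v]))"
      unfolding rest using v(2) xy by (simp add: card_Diff_N card_nbhd)
    fix x' y' assume "x' \<in> insert (last pre) (X - set (pre @ [v]))"
      and "y' \<in> insert (hd [v]) (Y - set (pre @ [v]))"
    then have "x' \<in> X" "y' \<in> N x"
      using a(1) N v(2) unfolding rest pre(6) by auto
    then show "adj E x' y'"
      using common unfolding common_nbhd_def by (metis in_nbhd subsetD)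
  qed simp_all
  then show False
    using no_path by contradiction
qed

lemma common_nbhd_if_saturated_pair:
  assumes sat: "saturated_pair x y" and deg: "d y = t + 1"
  shows "common_nbhd x"
  unfolding common_nbhd_def
proof (rule ballI, rule ccontr)
  fix x' assume x': "x' \<in> X" "\<not> N x \<subseteq> N x'"
  then obtain y' where y': "y' \<in> Y - (Y - N x)" "\<not> adj E x' y'"
    using saturated_pairD[OF sat] by (auto simp: N_X)
  have "t * (m - (t + 1)) + m \<le> card missing + t + 2"
    using card_missing_ge_columns_cross[of "Y - N x" "t + 1", OF _ _ x'(1) y']
      saturated_pair_degree_le[OF sat] card_saturated_pair_non_nbhd[OF sat] deg by auto
  moreover obtain z where "m = t + 3 + z"
    using m_gt le_Suc_ex[of "t + 3" m] by auto
  ultimately show False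
    using few_missing by (simp add: algebra_simps)
qed

lemma saturated_pair_missed_neighbour:
  assumes sat: "saturated_pair x y" and deg: "d y = t + 1" and common: "common_nbhd x"
    and z0: "z0 \<in> Y - N x" and a: "a \<in> N y" "\<not> adj E a z0"
  shows "a \<noteq> u" and "\<And>z. z \<in> Y - N x - {y} \<Longrightarrow> N y - {a} \<subseteq> N z"
proof -
  note xy = saturated_pairD[OF sat]
  have a_X: "a \<in> X"
    using a(1) xy(2) by (auto simp: N_Y)
  have sub: "Y - N a \<subseteq> Y - N x - {y}"
    using common a(1) a_X xy(2) by (auto simp: common_nbhd_def N_X N_Y)
  have card: "card (Y - N x - {y}) = t - 1"
    using card_saturated_pair_non_nbhd[OF sat] xy(5) deg by simp
  have "d a + d z0 \<le> m + 1"
    using closed a_X a(2) z0 by auto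
  moreover have "t \<le> d z0"
    using min_degree z0 by auto
  moreover have "m - d a \<le> t - 1"
    using card_mono[OF _ sub] card a_X by (simp add: card_Diff_N)
  ultimately have sum: "d a + d z0 = m + 1" and "m - d a = t - 1"
    using t_pos m_gt by linarith+
  then have N_a: "Y - N a = Y - N x - {y}"
    using card a_X sub by (intro card_subset_eq) (auto simp: card_Diff_N)
  show "a \<noteq> u"
    using closed_eq[OF a_X _ a(2) sum] z0 a(2) by auto
  fix z assume z: "z \<in> Y - N x - {y}"
  then have "N z \<subseteq> N y - {a}"
    using saturated_pair_N_subset[OF sat common, of z] N_a a_X by (auto simp: N_X N_Y)
  moreover have "card (N y - {a}) \<le> card (N z)"
    using a(1) deg min_degree[of z] z by (simp add: card_nbhd)
  ultimately have "N z = N y - {a}"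
    by (intro card_seteq) auto
  then show "N y - {a} \<subseteq> N z"
    by simp
qed

lemma degree_saturated_pair_neq:
  assumes sat: "saturated_pair x y"
  shows "d y \<noteq> t + 1"
proof
  assume deg: "d y = t + 1"
  note common = common_nbhd_if_saturated_pair[OF sat deg]
  show False
  proof (cases "\<forall>z\<in>Y - N x. N y \<subseteq> N z")
    case True
    have "\<not> N y \<subseteq> {u}"
      using card_mono[of "{u}" "N y"] deg t_pos by (auto simp: card_nbhd)
    then obtain a where "a \<in> N y - {u}"
      by blast
    with True show False
      by (intro no_saturated_pair_with_common_nbhd[OF sat common]) auto
  next
    case False
    then obtain z0 a where z0: "z0 \<in> Y - N x" and a: "a \<in> N y" "\<not> adj E a z0"
      using saturated_pairD(2)[OF sat] by (auto simp: N_Y)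
    note missed = saturated_pair_missed_neighbour[OF sat deg common z0 a]
    from missed(1) a(1) have "a \<in> N y - {u}"
      by simp
    from no_saturated_pair_with_common_nbhd[OF sat common this missed(2)] show False .
  qed
qed

lemma saturated_pair_degree_ge_two:
  assumes sat: "saturated_pair x y"
  shows "2 \<le> d y"
proof -
  have "0 < card (Y - N x)"
    using saturated_pairD(5)[OF sat] by (metis card_gt_0_iff empty_iff finite_Diff finite_Y)
  then show ?thesis
    using card_saturated_pair_non_nbhd[OF sat] by simp
qed

lemma not_common_nbhd_if_saturated_pair:
  assumes sat: "saturated_pair x y" and deg: "d y = t"
  shows "\<not> common_nbhd x"
proof
  assume common: "common_nbhd x"
  have N_eq: "N z = N y" if "z \<in> Y - N x" for z
    using saturated_pair_N_subset[OF sat common that] min_degree[of z] that deg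
    by (intro card_seteq) (auto simp: card_nbhd)
  have "\<not> N y \<subseteq> {u}"
    using card_mono[of "{u}" "N y"] saturated_pair_degree_ge_two[OF sat] by (auto simp: card_nbhd)
  then obtain a where "a \<in> N y - {u}"
    by blast
  with N_eq show False
    by (intro no_saturated_pair_with_common_nbhd[OF sat common]) auto
qed

lemma adjacent_if_complete_off_cross:
  assumes x0: "x0 \<in> X" "x0 \<noteq> u" "adj E x0 v" "d x0 = 2"
    and y0: "y0 \<in> Y" "y0 \<noteq> v" "adj E u y0" "d y0 = 2"
    and complete: "\<And>x y. x \<in> X - {x0} \<Longrightarrow> y \<in> Y - {y0} \<Longrightarrow> adj E x y"
  shows "adj E x0 y0"
proof (rule ccontr)
  assume na: "\<not> adj E x0 y0"
  have "u \<in> N y0" "v \<in> N x0"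
    using x0 y0 u v by (auto simp: N_X N_Y)
  then have "card (N y0 - {u}) = 1" "card (N x0 - {v}) = 1"
    using x0(4) y0(4) by (simp_all add: card_nbhd)
  then obtain a b where "N y0 - {u} = {a}" "N x0 - {v} = {b}"
    by (metis card_1_singletonE)
  then have "a \<in> N y0 - {u}" "b \<in> N x0 - {v}"
    by auto
  then have a: "a \<in> X" "a \<noteq> u" "a \<noteq> x0" "adj E a y0" and b: "b \<in> Y" "b \<noteq> v" "b \<noteq> y0" "adj E x0 b"
    using na x0(1) y0(1) by (auto simp: N_X N_Y)
  let ?pre = "[u, y0, a]" and ?suf = "[b, x0, v]"
  have rest: "X - set (?pre @ ?suf) = X - {u, a, x0}" "Y - set (?pre @ ?suf) = Y - {y0, b, v}"
    using a b u v x0 y0 disjoint by auto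
  have "\<exists>ps. ham_path E (X \<union> Y) u v ps"
  proof (rule ham_path_join[OF finite_X finite_Y disjoint])
    show "successively (adj E) ?pre" "successively (adj E) ?suf"
      using a(4) b(4) x0(3) y0(3) by (auto simp: adj_sym)
    show "distinct (?pre @ ?suf)"
      using a b u v x0(1,2) y0(1,2) disjoint by auto
    show "set (?pre @ ?suf) \<subseteq> X \<union> Y"
      using a(1) b(1) u v x0(1) y0(1) by auto
    show "card (X - set (?pre @ ?suf)) = card (Y - set (?pre @ ?suf))"
      unfolding rest using a(1-3) b(1-3) u v x0(1,2) y0(1,2)
      by (auto simp: card_Diff_subset card_X card_Y card_insert_if)
    fix x y assume "x \<in> insert (last ?pre) (X - set (?pre @ ?suf))"
      and "y \<in> insert (hd ?suf) (Y - set (?pre @ ?suf))"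
    then show "adj E x y"
      using a(1,3) b(1,3) unfolding rest by (intro complete) auto
  qed simp_all
  then show False
    using no_path by contradiction
qed

lemma degree_two_pair_adjacent:
  assumes t: "t = 2" and sat: "saturated_pair x y" and deg: "d y = 2"
    and x0: "x0 \<in> X" "y0 \<in> N x" "\<not> adj E x0 y0" "d x0 = 2"
  shows "adj E x0 y"
proof (rule adjacent_if_complete_off_cross)
  note xy = saturated_pairD[OF sat]
  have y0: "y0 \<in> Y - {y}"
    using x0(2) xy by (auto simp: N_X)
  show complete: "adj E x1 y1" if "x1 \<in> X - {x0}" "y1 \<in> Y - {y}" for x1 y1
  proof (rule ccontr)
    assume "\<not> adj E x1 y1"
    from card_missing_ge_two_crosses[OF x0(1) xy(2) that this] show False
      using few_missing t x0(4) deg m_gt by simp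
  qed
  have "X - {x0} \<subseteq> N y0"
    using complete y0 by (auto simp: N_Y)
  then have "m - 1 \<le> d y0"
    using card_mono[of "N y0" "X - {x0}"] x0(1) by (simp add: card_X card_nbhd)
  moreover have "d x0 + d y0 \<le> m + 1"
    using x0 y0 by (intro closed) auto
  ultimately have "saturated_pair x0 y0"
    using x0 y0 by (simp add: saturated_pair_def)
  from saturated_pair_ends[OF this] saturated_pair_ends[OF sat]
  show "x0 \<noteq> u" "adj E x0 v" "y \<noteq> v" "adj E u y"
    using x0(1,3) xy(1-3) y0 by (auto simp: N_X N_Y)
qed (use x0(1,4) saturated_pairD(2)[OF sat] deg in auto)

lemma ex_max_degree_sum_pair:
  assumes "S \<subseteq> missing" "S \<noteq> {}"
  obtains x y where "(x, y) \<in> S" "\<And>x' y'. (x', y') \<in> S \<Longrightarrow> d x' + d y' \<le> d x + d y"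
proof -
  have "finite S"
    using assms(1) by (rule finite_subset) simp
  then obtain q where q: "q \<in> S" "(case q of (x, y) \<Rightarrow> d x + d y) = (MAX (x, y)\<in>S. d x + d y)"
    using assms(2) obtains_MAX[of S "\<lambda>(x, y). d x + d y"] by metis
  have "d x' + d y' \<le> (MAX (x, y)\<in>S. d x + d y)" if "(x', y') \<in> S" for x' y'
    using Max_ge[OF finite_imageI[OF \<open>finite S\<close>] imageI[OF that, of "\<lambda>(x, y). d x + d y"]] by simp
  with q that show thesis
    by (cases q) auto
qed

lemma saturated_pair_second_pair:
  assumes sat: "saturated_pair x y" and deg: "d y = t"
  obtains x0 y0 where "x0 \<in> X" "y0 \<in> N x" "\<not> adj E x0 y0"
    "(t - 1) * (m - t) + card (N x - N x0) * (m - d y0) < (t + 1) * (m - t - 2)"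
proof -
  note xy = saturated_pairD[OF sat]
  define S where "S = missing \<inter> X \<times> N x"
  have "S \<subseteq> missing" "S \<noteq> {}"
    using not_common_nbhd_if_saturated_pair[OF sat deg] xy(1)
    by (auto simp: S_def common_nbhd_def non_adj_pairs_def N_X subset_iff)
  then obtain x0 y0 where S: "(x0, y0) \<in> S"
    and max: "\<And>x' y'. (x', y') \<in> S \<Longrightarrow> d x' + d y' \<le> d x0 + d y0"
    by (rule ex_max_degree_sum_pair) metis
  then have x0: "x0 \<in> X" "y0 \<in> N x" "\<not> adj E x0 y0"
    by (auto simp: S_def non_adj_pairs_def)
  define L R where "L = Y - N x" and "R = N x - N x0"
  have card_L: "card L = t - 1"
    using card_saturated_pair_non_nbhd[OF sat] deg by (simp add: L_def)
  have sub: "L \<subseteq> Y" "R \<subseteq> Y"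
    using xy(1) by (auto simp: L_def R_def N_X)
  have low_L: "d z \<le> t" if "z \<in> L" for z
    using saturated_pair_degree_le[OF sat] that deg by (simp add: L_def)
  have low_R: "d z \<le> d y0" if "z \<in> R" for z
    using max[of x0 z] that x0(1) xy(1) by (auto simp: S_def R_def non_adj_pairs_def N_X)
  have "card L * (m - t) + card R * (m - d y0) \<le> card (missing \<inter> X \<times> L) + card (missing \<inter> X \<times> R)"
    using low_L low_R sub by (intro add_mono card_missing_columns_ge)
  also have "\<dots> = card (missing \<inter> X \<times> L \<union> missing \<inter> X \<times> R)"
    by (intro card_Un_disjoint[symmetric]) (auto simp: L_def R_def)
  also have "\<dots> \<le> card missing"
    by (intro card_mono) auto
  also note few_missing
  finally show thesis
    using that[OF x0] unfolding card_L R_def by blast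
qed

lemma saturated_pair_second_pair_cases:
  assumes sat: "saturated_pair x y" and deg: "d y = t"
  obtains x0 y0 where "x0 \<in> X" "y0 \<in> N x" "\<not> adj E x0 y0" "m \<le> d x0 + t \<or> t = 2 \<and> d x0 = 2"
proof -
  obtain x0 y0 where x0: "x0 \<in> X" "y0 \<in> N x" "\<not> adj E x0 y0"
    and few: "(t - 1) * (m - t) + card (N x - N x0) * (m - d y0) < (t + 1) * (m - t - 2)"
    by (rule saturated_pair_second_pair[OF sat deg])
  have y0: "y0 \<in> Y" "y0 \<in> N x - N x0"
    using x0 saturated_pairD(1)[OF sat] by (auto simp: N_X)
  have "card (Y - N x0) \<le> card ((Y - N x) \<union> (N x - N x0))"
    by (intro card_mono) auto
  also have "\<dots> \<le> card (Y - N x) + card (N x - N x0)"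
    by (rule card_Un_le)
  finally have m_le: "m \<le> d x0 + (t - 1) + card (N x - N x0)"
    using x0(1) card_saturated_pair_non_nbhd[OF sat] deg by (simp add: card_Diff_N)
  have "1 \<le> card (N x - N x0)"
    using y0(2) by (metis One_nat_def Suc_leI card_gt_0_iff empty_iff finite_Diff finite_N)
  moreover have "2 \<le> t" "t \<le> d x0" "d y0 \<le> m"
    using saturated_pair_degree_ge_two[OF sat] deg min_degree[of x0] d_le[of y0] x0(1) y0(1) by auto
  ultimately have "card (N x - N x0) = 1 \<or> t = 2 \<and> d x0 = 2"
    using closed[OF x0(1) y0(1) x0(3)] m_gt m_le few by (intro second_pair_degree_cases)
  with m_le t_pos show thesis
    by (intro that[OF x0]) auto
qed

lemma low_degree_structure_saturated_pair:
  assumes sat: "saturated_pair x y" and deg: "d y = t"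
  shows "low_degree_structure X Y E t t"
proof -
  note xy = saturated_pairD[OF sat]
  obtain x0 y0 where x0: "x0 \<in> X" "y0 \<in> N x" "\<not> adj E x0 y0"
    and cases: "m \<le> d x0 + t \<or> t = 2 \<and> d x0 = 2"
    by (rule saturated_pair_second_pair_cases[OF sat deg])
  have y0: "y0 \<in> Y" "y0 \<notin> Y - N x"
    using x0(2) xy(1) by (auto simp: N_X)
  from cases show ?thesis
  proof
    assume "m \<le> d x0 + t"
    moreover have "d x0 + d y0 \<le> m + 1"
      by (rule closed[OF x0(1) y0(1) x0(3)])
    moreover have "d y0 \<noteq> t + 1" if "d x0 + d y0 = m + 1"
      using that x0 y0(1) by (intro degree_saturated_pair_neq) (simp add: saturated_pair_def)
    ultimately have "d y0 \<le> t"
      by linarith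
    then have "\<forall>z\<in>insert y0 (Y - N x). d z \<le> t"
      using saturated_pair_degree_le[OF sat] deg by auto
    moreover have "card (insert y0 (Y - N x)) = t" "insert y0 (Y - N x) \<subseteq> Y"
      using y0 card_saturated_pair_non_nbhd[OF sat] deg t_pos by (auto simp: card_insert_if)
    ultimately show ?thesis
      unfolding low_degree_structure_def by blast
  next
    assume two: "t = 2 \<and> d x0 = 2"
    then have "adj E x0 y"
      using degree_two_pair_adjacent[OF _ sat _ x0] deg by simp
    then show ?thesis
      unfolding low_degree_structure_def using two x0(1) xy(2) deg
      by (intro disjI2 conjI bexI[of _ x0] bexI[of _ y]) simp_all
  qed
qed

lemma low_degree_structure_max_pair:
  assumes xy: "x \<in> X" "y \<in> Y" "\<not> adj E x y" "d y \<le> d x"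
    and max: "\<And>x' y'. x' \<in> X \<Longrightarrow> y' \<in> Y \<Longrightarrow> \<not> adj E x' y' \<Longrightarrow> d x' + d y' \<le> d x + d y"
  shows "low_degree_structure X Y E t t"
proof -
  have low: "d z \<le> d y" if "z \<in> Y - N x" for z
    using max[of x z] that xy(1) by (auto simp: N_X)
  have "(m - d x) * (m - d y) = card (Y - N x) * (m - d y)"
    using xy(1) by (simp add: card_Diff_N)
  also have "\<dots> \<le> card (missing \<inter> X \<times> (Y - N x))"
    by (rule card_missing_columns_ge[OF _ low]) auto
  also have "\<dots> \<le> card missing"
    by (rule card_mono) auto
  also note few_missing
  finally have few: "(m - d x) * (m - d y) < (t + 1) * (m - t - 2)" .
  have "t \<le> d y" "d x \<le> m"
    using min_degree d_le xy(1,2) by auto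
  from max_pair_degree_cases[OF this(1) xy(4) this(2) closed[OF xy(1-3)] few]
  consider "d y = t" "d x = m - t" | "saturated_pair x y" "d y = t \<or> d y = t + 1"
    using xy by (auto simp: saturated_pair_def)
  then show ?thesis
  proof cases
    case 1
    then have "card (Y - N x) = t" "\<forall>z\<in>Y - N x. d z \<le> t"
      using low xy(1) m_gt by (auto simp: card_Diff_N)
    then show ?thesis
      unfolding low_degree_structure_def by blast
  next
    case 2
    then show ?thesis
      using low_degree_structure_saturated_pair degree_saturated_pair_neq by blast
  qed
qed

lemma missing_nonempty: "missing \<noteq> {}"
proof
  assume "missing = {}"
  then have "adj E x y" if "x \<in> X" "y \<in> Y" for x y
    using that by (auto simp: non_adj_pairs_def)
  moreover have "X - {u, v} = X - {u}" "Y - {u, v} = Y - {v}"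
    using u v disjoint by auto
  ultimately have "\<exists>ps. ham_path E (X \<union> Y) u v ps"
    using u v disjoint by (intro ham_path_join[of X Y "[u]" u E "[v]"]) (auto simp: card_X card_Y)
  with no_path show False
    by contradiction
qed

theorem low_degree_structure_of_closed: "low_degree_structure X Y E t t"
proof -
  obtain x y where xy: "(x, y) \<in> missing"
    and max: "\<And>x' y'. (x', y') \<in> missing \<Longrightarrow> d x' + d y' \<le> d x + d y"
    using ex_max_degree_sum_pair[OF subset_refl missing_nonempty] by metis
  from xy have xy: "x \<in> X" "y \<in> Y" "\<not> adj E x y"
    by (auto simp: non_adj_pairs_def)
  have max: "d x' + d y' \<le> d x + d y" if "x' \<in> X" "y' \<in> Y" "\<not> adj E x' y'" for x' y'
    using max[of x' y'] that by (simp add: non_adj_pairs_def)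
  show ?thesis
  proof (cases "d y \<le> d x")
    case True
    then show ?thesis
      using low_degree_structure_max_pair[OF xy _ max] by blast
  next
    case False
    interpret swapped: closed_bigraph Y X E v u m t
      by (rule closed_bigraph_swap)
    have "low_degree_structure Y X E t t"
    proof (rule swapped.low_degree_structure_max_pair[OF xy(2,1)])
      show "\<not> adj E y x" "swapped.d x \<le> swapped.d y"
        using xy(3) False by (simp_all add: adj_sym Un_commute)
      show "swapped.d y' + swapped.d x' \<le> swapped.d y + swapped.d x"
        if "y' \<in> Y" "x' \<in> X" "\<not> adj E y' x'" for y' x'
        using max[of x' y'] that by (simp add: adj_sym Un_commute add.commute)
    qed
    then show ?thesis
      by (simp add: low_degree_structure_commute)
  qed
qed

end

lemma low_degree_structure_subgraph:
  assumes fin: "finite (X \<union> Y)" and EF: "E \<subseteq> F" and low: "low_degree_structure X Y F t t"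
    and min_degree: "\<And>x. x \<in> X \<union> Y \<Longrightarrow> t \<le> degree (X \<union> Y) E x"
  shows "low_degree_structure X Y E t t"
proof -
  have degree_le: "degree (X \<union> Y) E x \<le> t" if "degree (X \<union> Y) F x \<le> t" for x
    using that degree_mono[OF fin EF, of x] by simp
  have nbhd_eq: "nbhd (X \<union> Y) E x = nbhd (X \<union> Y) F x" if "x \<in> X" "degree (X \<union> Y) F x \<le> t" for x
    using min_degree[of x] that
    by (intro card_seteq finite_nbhd fin nbhd_mono EF) (auto simp: card_nbhd)
  have adj: "adj E x y" if "x \<in> X" "y \<in> Y" "adj F x y" "degree (X \<union> Y) F x \<le> t" for x y
    using nbhd_eq[OF that(1,4)] that by (auto simp: nbhd_def)

  consider T where "T \<subseteq> X \<or> T \<subseteq> Y" "card T = t" "\<forall>x\<in>T. degree (X \<union> Y) F x \<le> t"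
    | x y where "t = 2" "x \<in> X" "y \<in> Y" "adj F x y" "degree (X \<union> Y) F x \<le> t" "degree (X \<union> Y) F y \<le> t"
    using low unfolding low_degree_structure_def by metis
  then show ?thesis
  proof cases
    case 1
    then show ?thesis
      unfolding low_degree_structure_def using degree_le by blast
  next
    case 2
    then show ?thesis
      unfolding low_degree_structure_def using degree_le adj by blast
  qed
qed

lemma ex_edge_maximal_non_ham_path:
  assumes bip: "bipartite_graph X Y E" and no: "\<nexists>ps. ham_path E (X \<union> Y) u v ps"
  obtains F where "E \<subseteq> F" "bipartite_graph X Y F" "\<nexists>ps. ham_path F (X \<union> Y) u v ps"
    "\<And>x y. x \<in> X \<Longrightarrow> y \<in> Y \<Longrightarrow> \<not> adj F x y \<Longrightarrow> \<exists>ps. ham_path (insert {x, y} F) (X \<union> Y) u v ps"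
proof -
  define P where "P = {{x, y} | x y. x \<in> X \<and> y \<in> Y}"
  define FS where "FS = {F. E \<subseteq> F \<and> F \<subseteq> P \<and> (\<nexists>ps. ham_path F (X \<union> Y) u v ps)}"
  have bip_iff: "bipartite_graph X Y F \<longleftrightarrow> F \<subseteq> P" for F
    using bip by (auto simp: bipartite_graph_def P_def)
  have "P = (\<lambda>(x, y). {x, y}) ` (X \<times> Y)"
    by (auto simp: P_def)
  then have "finite FS"
    using bipartite_graphD[OF bip] by (intro finite_subset[of FS "Pow P"]) (auto simp: FS_def)
  moreover have "E \<in> FS"
    using bip no by (simp add: FS_def bip_iff)
  ultimately obtain F where F: "F \<in> FS" "\<And>F'. F' \<in> FS \<Longrightarrow> F \<subseteq> F' \<Longrightarrow> F = F'"
    using finite_has_maximal[of FS] by blast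
  show thesis
  proof (rule that)
    show "E \<subseteq> F" "bipartite_graph X Y F" "\<nexists>ps. ham_path F (X \<union> Y) u v ps"
      using F(1) by (auto simp: FS_def bip_iff)
    fix x y assume xy: "x \<in> X" "y \<in> Y" "\<not> adj F x y"
    show "\<exists>ps. ham_path (insert {x, y} F) (X \<union> Y) u v ps"
    proof (rule ccontr)
      assume "\<not> ?thesis"
      then have "insert {x, y} F \<in> FS"
        using F(1) xy(1,2) by (auto simp: FS_def P_def)
      from F(2)[OF this] xy(3) show False
        by (auto simp: adj_def)
    qed
  qed
qed

theorem low_degree_structure_if_no_ham_path:
  assumes bip: "bipartite_graph X Y E" and card: "card X = m" "card Y = m" and uv: "u \<in> X" "v \<in> Y"
    and deg: "\<And>x. x \<in> X \<union> Y \<Longrightarrow> t \<le> degree (X \<union> Y) E x" and t: "1 \<le> t"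
    and few: "card (non_adj_pairs X Y E) < (t + 1) * (m - t - 2)"
    and no: "\<nexists>ps. ham_path E (X \<union> Y) u v ps"
  shows "low_degree_structure X Y E t t"
proof -
  note fin = bipartite_graphD[OF bip]
  obtain F where F: "E \<subseteq> F" "bipartite_graph X Y F" "\<nexists>ps. ham_path F (X \<union> Y) u v ps"
    "\<And>x y. x \<in> X \<Longrightarrow> y \<in> Y \<Longrightarrow> \<not> adj F x y \<Longrightarrow> \<exists>ps. ham_path (insert {x, y} F) (X \<union> Y) u v ps"
    by (rule ex_edge_maximal_non_ham_path[OF bip no]) blast
  have degree_le: "degree (X \<union> Y) E x \<le> degree (X \<union> Y) F x" for x
    using fin F(1) by (intro degree_mono) auto
  note closed = degree_sum_le_if_edge_creates_ham_path[OF F(2) card _ _ uv F(3,4)]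
  interpret closed_bigraph X Y F u v m t
  proof
    show "t \<le> degree (X \<union> Y) F x" if "x \<in> X \<union> Y" for x
      using deg[OF that] degree_le[of x] by simp
    have "card (non_adj_pairs X Y F) \<le> card (non_adj_pairs X Y E)"
      using fin F(1) by (intro card_mono finite_non_adj_pairs non_adj_pairs_mono) auto
    then show "card (non_adj_pairs X Y F) < (t + 1) * (m - t - 2)"
      using few by simp
  qed (use F card uv t closed in auto)
  show ?thesis
    by (rule low_degree_structure_subgraph[OF _ F(1) low_degree_structure_of_closed deg])
      (use fin in auto)
qed

section \<open>Symmetric matrices indexed by a finite set\<close>

definition inprod :: "'a set \<Rightarrow> ('a \<Rightarrow> real) \<Rightarrow> ('a \<Rightarrow> real) \<Rightarrow> real" where
  "inprod V f g = (\<Sum>x\<in>V. f x * g x)"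

definition mat_vec :: "'a set \<Rightarrow> ('a \<Rightarrow> 'a \<Rightarrow> real) \<Rightarrow> ('a \<Rightarrow> real) \<Rightarrow> 'a \<Rightarrow> real" where
  "mat_vec V A f x = (\<Sum>y\<in>V. A x y * f y)"

definition eigenvector :: "'a set \<Rightarrow> ('a \<Rightarrow> 'a \<Rightarrow> real) \<Rightarrow> real \<Rightarrow> ('a \<Rightarrow> real) \<Rightarrow> bool" where
  "eigenvector V A l f \<longleftrightarrow> (\<exists>x\<in>V. f x \<noteq> 0) \<and> (\<forall>x\<in>V. mat_vec V A f x = l * f x)"

definition eigenvalues :: "'a set \<Rightarrow> ('a \<Rightarrow> 'a \<Rightarrow> real) \<Rightarrow> real set" where
  "eigenvalues V A = {l. \<exists>f. eigenvector V A l f}"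

definition max_eigenvalue :: "'a set \<Rightarrow> ('a \<Rightarrow> 'a \<Rightarrow> real) \<Rightarrow> real" where
  "max_eigenvalue V A = Max (eigenvalues V A)"

lemma inprod_commute: "inprod V f g = inprod V g f"
  by (simp add: inprod_def mult.commute)

lemma inprod_add_right: "inprod V f (\<lambda>x. g x + h x) = inprod V f g + inprod V f h"
  by (simp add: inprod_def distrib_left sum.distrib)

lemma inprod_add_left: "inprod V (\<lambda>x. f x + g x) h = inprod V f h + inprod V g h"
  by (simp add: inprod_def distrib_right sum.distrib)

lemma inprod_diff_right: "inprod V f (\<lambda>x. g x - h x) = inprod V f g - inprod V f h"
  by (simp add: inprod_def right_diff_distrib sum_subtractf)

lemma inprod_scale_right: "inprod V f (\<lambda>x. c * g x) = c * inprod V f g"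
  by (simp add: inprod_def sum_distrib_left mult_ac)

lemma inprod_scale_left: "inprod V (\<lambda>x. c * f x) g = c * inprod V f g"
  by (simp add: inprod_def sum_distrib_left mult_ac)

lemma inprod_sum_right: "inprod V f (\<lambda>x. \<Sum>i\<in>S. g i x) = (\<Sum>i\<in>S. inprod V f (g i))"
  unfolding inprod_def sum_distrib_left by (rule sum.swap)

lemma inprod_cong:
  "(\<And>x. x \<in> V \<Longrightarrow> f x = f' x) \<Longrightarrow> (\<And>x. x \<in> V \<Longrightarrow> g x = g' x) \<Longrightarrow> inprod V f g = inprod V f' g'"
  by (simp add: inprod_def)

lemma inprod_self_nonneg: "0 \<le> inprod V f f"
  by (simp add: inprod_def sum_nonneg)

lemma square_le_inprod_self:
  assumes "finite V" "x \<in> V"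
  shows "(f x)\<^sup>2 \<le> inprod V f f"
  unfolding inprod_def power2_eq_square using assms by (intro member_le_sum) auto

lemma inprod_self_pos:
  assumes "finite V" "x \<in> V" "f x \<noteq> 0"
  shows "0 < inprod V f f"
  using square_le_inprod_self[OF assms(1,2), of f] assms(3) by (smt (verit) zero_less_power2)

lemma ex_normalizing_scalar:
  assumes "0 < inprod V f f"
  obtains c where "c\<^sup>2 * inprod V f f = 1" "inprod V (\<lambda>x. c * f x) (\<lambda>x. c * f x) = 1"
proof -
  define c where "c = 1 / sqrt (inprod V f f)"
  have "c\<^sup>2 * inprod V f f = 1"
    using assms by (simp add: c_def power_divide)
  then show thesis
    using that[of c] by (simp add: inprod_scale_left inprod_scale_right power2_eq_square)
qed

lemma inprod_unit_vector:
  assumes "finite V" "x \<in> V"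
  shows "inprod V (\<lambda>y. of_bool (y = x)) f = f x"
  using assms by (simp add: inprod_def of_bool_def if_distrib[of "\<lambda>a. a * _"] sum.delta' cong: if_cong)

lemma mat_vec_scale: "mat_vec V A (\<lambda>x. c * f x) = (\<lambda>x. c * mat_vec V A f x)"
  by (simp add: mat_vec_def sum_distrib_left mult_ac fun_eq_iff)

lemma mat_vec_add: "mat_vec V A (\<lambda>x. f x + g x) = (\<lambda>x. mat_vec V A f x + mat_vec V A g x)"
  by (simp add: mat_vec_def distrib_left sum.distrib fun_eq_iff)

lemma eigenvector_scale:
  assumes "eigenvector V A l f" "c \<noteq> 0"
  shows "eigenvector V A l (\<lambda>x. c * f x)"
  using assms by (auto simp: eigenvector_def mat_vec_scale)

lemma inprod_eigenvector:
  assumes "eigenvector V A l g"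
  shows "inprod V f (mat_vec V A g) = l * inprod V f g"
proof -
  have "inprod V f (mat_vec V A g) = inprod V f (\<lambda>x. l * g x)"
    using assms by (intro inprod_cong) (auto simp: eigenvector_def)
  then show ?thesis
    by (simp add: inprod_scale_right)
qed

lemma bessel_inequality:
  fixes w :: "'b \<Rightarrow> 'a \<Rightarrow> real"
  assumes S: "finite S"
    and orth: "\<And>i j. i \<in> S \<Longrightarrow> j \<in> S \<Longrightarrow> inprod V (w i) (w j) = of_bool (i = j)"
  shows "(\<Sum>i\<in>S. (inprod V f (w i))\<^sup>2) \<le> inprod V f f"
proof -
  define c where "c i = inprod V f (w i)" for i
  define p where "p x = (\<Sum>i\<in>S. c i * w i x)" for x
  have inprod_p: "inprod V g p = (\<Sum>i\<in>S. c i * inprod V g (w i))" for g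
    unfolding p_def by (simp add: inprod_sum_right inprod_scale_right)
  have fp: "inprod V f p = (\<Sum>i\<in>S. (c i)\<^sup>2)"
    by (simp add: inprod_p c_def power2_eq_square)
  have "inprod V p (w j) = c j" if "j \<in> S" for j
  proof -
    have "inprod V p (w j) = (\<Sum>i\<in>S. c i * of_bool (j = i))"
      unfolding inprod_commute[of V p] inprod_p using orth that by (intro sum.cong) auto
    then show ?thesis
      using S that by (simp add: of_bool_def if_distrib sum.delta cong: if_cong)
  qed
  then have pp: "inprod V p p = (\<Sum>i\<in>S. (c i)\<^sup>2)"
    by (simp add: inprod_p power2_eq_square)
  have "0 \<le> inprod V (\<lambda>x. f x - p x) (\<lambda>x. f x - p x)"
    by (rule inprod_self_nonneg)
  also have "\<dots> = inprod V f f - 2 * inprod V f p + inprod V p p"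
    by (simp add: inprod_diff_right inprod_commute[of V "\<lambda>x. f x - p x"] inprod_commute[of V p f])
  finally show ?thesis
    by (simp add: fp pp c_def)
qed

lemma orthonormal_card_le:
  fixes w :: "'b \<Rightarrow> 'a \<Rightarrow> real"
  assumes V: "finite V" and S: "finite S"
    and orth: "\<And>i j. i \<in> S \<Longrightarrow> j \<in> S \<Longrightarrow> inprod V (w i) (w j) = of_bool (i = j)"
  shows "card S \<le> card V"
proof -
  have "real (card S) = (\<Sum>i\<in>S. \<Sum>x\<in>V. (w i x)\<^sup>2)"
    using orth by (simp add: inprod_def power2_eq_square)
  also have "\<dots> = (\<Sum>x\<in>V. \<Sum>i\<in>S. (w i x)\<^sup>2)"
    by (rule sum.swap)
  also have "\<dots> \<le> (\<Sum>x\<in>V. 1)"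
  proof (rule sum_mono)
    fix x assume x: "x \<in> V"
    let ?e = "\<lambda>y. of_bool (y = x) :: real"
    show "(\<Sum>i\<in>S. (w i x)\<^sup>2) \<le> 1"
      using bessel_inequality[OF S orth, where f = ?e] inprod_unit_vector[OF V x] by simp
  qed
  finally show ?thesis
    by simp
qed

lemma compact_unit_sphere:
  assumes fin: "finite V"
  shows "compact {f :: 'a \<Rightarrow> real. (\<forall>x. x \<notin> V \<longrightarrow> f x = 0) \<and> inprod V f f = 1}" (is "compact ?S")
proof -
  define K :: "('a \<Rightarrow> real) set" where "K = PiE UNIV (\<lambda>x. if x \<in> V then {-1..1} else {0})"
  have "compact K"
    unfolding K_def compactin_euclidean_iff[symmetric] euclidean_product_topology[symmetric]
    by (subst compactin_PiE) auto
  have "continuous_on UNIV (\<lambda>f. inprod V f f)"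
    unfolding inprod_def by (intro continuous_intros continuous_on_product_coordinates)
  then have "closed {f. inprod V f f = 1}"
    by (intro closed_Collect_eq continuous_on_const)
  with \<open>compact K\<close> have "compact (K \<inter> {f. inprod V f f = 1})"
    by (rule compact_Int_closed)
  moreover have "\<bar>f x\<bar> \<le> 1" if "inprod V f f = 1" "x \<in> V" for f x
    using square_le_inprod_self[OF fin that(2), of f] that(1) by (simp add: abs_square_le_1)
  then have "?S = K \<inter> {f. inprod V f f = 1}"
    by (fastforce simp: K_def PiE_def Pi_iff abs_le_iff split: if_splits)
  ultimately show ?thesis
    by simp
qed

locale symmetric_matrix =
  fixes V :: "'a set" and A :: "'a \<Rightarrow> 'a \<Rightarrow> real"
  assumes finite_V: "finite V" and nonempty: "V \<noteq> {}"
    and symmetric: "\<And>x y. x \<in> V \<Longrightarrow> y \<in> V \<Longrightarrow> A x y = A y x"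
begin

abbreviation form :: "('a \<Rightarrow> real) \<Rightarrow> real" where "form f \<equiv> inprod V f (mat_vec V A f)"

lemma self_adjoint: "inprod V f (mat_vec V A g) = inprod V g (mat_vec V A f)"
proof -
  have "inprod V f (mat_vec V A g) = (\<Sum>x\<in>V. \<Sum>y\<in>V. f x * (A x y * g y))"
    by (simp add: inprod_def mat_vec_def sum_distrib_left)
  also have "\<dots> = (\<Sum>y\<in>V. \<Sum>x\<in>V. f x * (A x y * g y))"
    by (rule sum.swap)
  also have "\<dots> = (\<Sum>y\<in>V. \<Sum>x\<in>V. g y * (A y x * f x))"
    using symmetric by (intro sum.cong refl) simp
  finally show ?thesis
    by (simp add: inprod_def mat_vec_def sum_distrib_left)
qed

lemma eigenvectors_orthogonal:
  assumes "eigenvector V A l f" "eigenvector V A l' g" "l \<noteq> l'"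
  shows "inprod V f g = 0"
proof -
  have "l' * inprod V f g = l * inprod V g f"
    using self_adjoint[of f g] assms(1,2) by (simp add: inprod_eigenvector)
  then show ?thesis
    using assms(3) by (simp add: inprod_commute[of V g])
qed

lemma finite_eigenvalues: "finite (eigenvalues V A)"
proof -
  have "\<exists>f. eigenvector V A l f \<and> inprod V f f = 1" if l: "l \<in> eigenvalues V A" for l
  proof -
    obtain f where f: "eigenvector V A l f"
      using l by (auto simp: eigenvalues_def)
    then have "0 < inprod V f f"
      using inprod_self_pos[OF finite_V] by (auto simp: eigenvector_def)
    then obtain c where c: "c\<^sup>2 * inprod V f f = 1" "inprod V (\<lambda>x. c * f x) (\<lambda>x. c * f x) = 1"
      by (rule ex_normalizing_scalar)
    then have "c \<noteq> 0"
      by auto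
    then show ?thesis
      using eigenvector_scale[OF f] c(2) by blast
  qed
  then obtain w where w: "\<And>l. l \<in> eigenvalues V A \<Longrightarrow> eigenvector V A l (w l) \<and> inprod V (w l) (w l) = 1"
    by metis
  have "card S \<le> card V" if "S \<subseteq> eigenvalues V A" "finite S" for S
  proof (rule orthonormal_card_le[OF finite_V that(2), of w])
    show "inprod V (w i) (w j) = of_bool (i = j)" if "i \<in> S" "j \<in> S" for i j
      using w[of i] w[of j] eigenvectors_orthogonal[of i "w i" j "w j"] \<open>S \<subseteq> _\<close> that
      by (cases "i = j") auto
  qed
  then show ?thesis
    by (meson finite_if_finite_subsets_card_bdd)
qed

lemma form_scale_cong:
  assumes "\<And>x. x \<in> V \<Longrightarrow> g' x = c * g x"
  shows "form g' = c\<^sup>2 * form g" "inprod V g' g' = c\<^sup>2 * inprod V g g"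
  using assms by (simp_all add: inprod_def mat_vec_def sum_distrib_left power2_eq_square mult_ac)

lemma ex_form_maximizer: "\<exists>f. inprod V f f = 1 \<and> (\<forall>g. form g \<le> form f * inprod V g g)"
proof -
  define S where "S = {f :: 'a \<Rightarrow> real. (\<forall>x. x \<notin> V \<longrightarrow> f x = 0) \<and> inprod V f f = 1}"
  obtain x where "x \<in> V"
    using nonempty by blast
  then have "(\<lambda>y. of_bool (y = x)) \<in> S"
    using inprod_unit_vector[OF finite_V] by (auto simp: S_def)
  then have "S \<noteq> {}"
    by blast
  have "continuous_on S (\<lambda>f. f x)" for x
    by (rule continuous_on_subset[OF continuous_on_product_coordinates]) simp
  then have "continuous_on S form"
    unfolding inprod_def mat_vec_def by (intro continuous_intros)
  from continuous_attains_sup[OF _ \<open>S \<noteq> {}\<close> this]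
  obtain f where f: "f \<in> S" "\<And>g. g \<in> S \<Longrightarrow> form g \<le> form f"
    using compact_unit_sphere[OF finite_V] by (auto simp: S_def)
  have "form g \<le> form f * inprod V g g" for g
  proof (cases "\<exists>x\<in>V. g x \<noteq> 0")
    case True
    then have "0 < inprod V g g"
      using inprod_self_pos[OF finite_V] by blast
    then obtain c where c: "c\<^sup>2 * inprod V g g = 1"
      by (rule ex_normalizing_scalar)
    define g' where "g' x = (if x \<in> V then c * g x else 0)" for x
    have form_g': "form g' = c\<^sup>2 * form g" "inprod V g' g' = 1"
      using form_scale_cong[of g' c g] c by (simp_all add: g'_def)
    then have "g' \<in> S"
      by (simp add: S_def g'_def)
    have "form g = form g' * inprod V g g"
      using c form_g'(1) by (metis mult.assoc mult.commute mult_1)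
    also have "\<dots> \<le> form f * inprod V g g"
      using f(2)[OF \<open>g' \<in> S\<close>] \<open>0 < inprod V g g\<close> by (intro mult_right_mono) auto
    finally show ?thesis .
  next
    case False
    then show ?thesis
      by (simp add: inprod_def)
  qed
  then show ?thesis
    using f(1) by (auto simp: S_def)
qed

lemma form_maximizer_eigenvector:
  assumes bound: "\<And>g. form g \<le> l * inprod V g g" and attained: "form f = l * inprod V f f"
    and nz: "\<exists>x\<in>V. f x \<noteq> 0"
  shows "eigenvector V A l f"
proof -
  have "inprod V h (mat_vec V A f) = l * inprod V h f" for h
  proof -
    define b where "b = inprod V h (mat_vec V A f) - l * inprod V h f"
    define q where "q = form h - l * inprod V h h"
    have expand: "form (\<lambda>x. f x + e * h x) - l * inprod V (\<lambda>x. f x + e * h x) (\<lambda>x. f x + e * h x) =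
      2 * b * e + q * e\<^sup>2" for e
      using attained inprod_commute[of V f h]
      by (simp add: b_def q_def mat_vec_add mat_vec_scale inprod_add_left inprod_add_right
          inprod_scale_left inprod_scale_right self_adjoint[of f h] power2_eq_square algebra_simps)
    have "2 * b * e + q * e\<^sup>2 \<le> 0" for e
      using bound[of "\<lambda>x. f x + e * h x"] expand[of e] by simp
    then have "\<forall>e. \<bar>0 - e\<bar> < 1 \<longrightarrow> 2 * b * e + q * e\<^sup>2 \<le> 2 * b * 0 + q * 0\<^sup>2"
      by simp
    moreover have "((\<lambda>e. 2 * b * e + q * e\<^sup>2) has_real_derivative 2 * b) (at 0)"
      by (auto intro!: derivative_eq_intros)
    ultimately have "2 * b = 0"
      by (rule DERIV_local_max[rotated 2]) simp
    then show ?thesis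
      by (simp add: b_def)
  qed
  then have "mat_vec V A f x = l * f x" if "x \<in> V" for x
    using inprod_unit_vector[OF finite_V that] by metis
  with nz show ?thesis
    by (simp add: eigenvector_def)
qed

lemma form_le: "form g \<le> max_eigenvalue V A * inprod V g g"
  and max_eigenvalue_in: "max_eigenvalue V A \<in> eigenvalues V A"
proof -
  obtain f where f: "inprod V f f = 1" "\<And>g. form g \<le> form f * inprod V g g"
    using ex_form_maximizer by blast
  have "\<exists>x\<in>V. f x \<noteq> 0"
  proof (rule ccontr)
    assume "\<not> ?thesis"
    then have "inprod V f f = 0"
      by (simp add: inprod_def)
    with f(1) show False
      by simp
  qed
  then have "eigenvector V A (form f) f"
    using f by (intro form_maximizer_eigenvector) simp_all
  then have "form f \<in> eigenvalues V A"
    by (auto simp: eigenvalues_def)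
  then show "max_eigenvalue V A \<in> eigenvalues V A"
    unfolding max_eigenvalue_def using finite_eigenvalues by (intro Max_in) auto
  have "form f \<le> max_eigenvalue V A"
    unfolding max_eigenvalue_def using finite_eigenvalues \<open>form f \<in> _\<close> by (rule Max_ge)
  then have "form f * inprod V g g \<le> max_eigenvalue V A * inprod V g g"
    by (rule mult_right_mono) (rule inprod_self_nonneg)
  with f(2)[of g] show "form g \<le> max_eigenvalue V A * inprod V g g"
    by simp
qed

end

locale nonneg_symmetric_matrix = symmetric_matrix +
  assumes nonneg: "\<And>x y. x \<in> V \<Longrightarrow> y \<in> V \<Longrightarrow> 0 \<le> A x y"
begin

lemma ex_nonneg_max_eigenvector:
  obtains f where "\<And>x. 0 \<le> f x" "eigenvector V A (max_eigenvalue V A) f"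
proof -
  obtain f where f: "eigenvector V A (max_eigenvalue V A) f"
    using max_eigenvalue_in by (auto simp: eigenvalues_def)
  let ?g = "\<lambda>x. \<bar>f x\<bar>"
  have "max_eigenvalue V A * inprod V ?g ?g = form f"
    unfolding inprod_eigenvector[OF f] by (simp add: inprod_def)
  also have "\<dots> \<le> form ?g"
    unfolding inprod_def mat_vec_def sum_distrib_left
  proof (intro sum_mono)
    fix x y assume "x \<in> V" "y \<in> V"
    then have "A x y * (f x * f y) \<le> A x y * (\<bar>f x\<bar> * \<bar>f y\<bar>)"
      using nonneg by (intro mult_left_mono) (simp_all flip: abs_mult)
    then show "f x * (A x y * f y) \<le> \<bar>f x\<bar> * (A x y * \<bar>f y\<bar>)"
      by (simp add: mult_ac)
  qed
  finally have "form ?g = max_eigenvalue V A * inprod V ?g ?g"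
    using form_le[of ?g] by simp
  moreover have "\<exists>x\<in>V. ?g x \<noteq> 0"
    using f by (auto simp: eigenvector_def)
  ultimately have "eigenvector V A (max_eigenvalue V A) ?g"
    using form_le by (intro form_maximizer_eigenvector) simp_all
  then show thesis
    using that[of ?g] by simp
qed

text \<open>The Collatz--Wielandt bound: pair w with a nonnegative eigenvector.\<close>

lemma max_eigenvalue_le:
  assumes pos: "\<And>x. x \<in> V \<Longrightarrow> 0 < w x" and row: "\<And>x. x \<in> V \<Longrightarrow> mat_vec V A w x \<le> l * w x"
  shows "max_eigenvalue V A \<le> l"
proof -
  obtain f where f: "\<And>x. 0 \<le> f x" "eigenvector V A (max_eigenvalue V A) f"
    using ex_nonneg_max_eigenvector by metis
  obtain x where x: "x \<in> V" "f x \<noteq> 0"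
    using f(2) by (auto simp: eigenvector_def)
  have "0 < w x * f x"
    using pos[OF x(1)] f(1)[of x] x(2) by simp
  also have "\<dots> \<le> inprod V w f"
    unfolding inprod_def using finite_V x(1) pos f(1) by (intro member_le_sum) (auto simp: less_imp_le)
  finally have "0 < inprod V w f" .
  have "max_eigenvalue V A * inprod V w f = inprod V f (mat_vec V A w)"
    using self_adjoint[of f w] inprod_eigenvector[OF f(2)] by simp
  also have "\<dots> \<le> inprod V f (\<lambda>x. l * w x)"
    unfolding inprod_def using row f(1) by (intro sum_mono mult_left_mono)
  also have "\<dots> = l * inprod V w f"
    by (simp add: inprod_scale_right inprod_commute)
  finally show ?thesis
    using \<open>0 < inprod V w f\<close> by simp
qed

lemma nonneg_eigenvector_pos_if_neighbour_pos:
  assumes f: "eigenvector V A l f" "\<And>x. 0 \<le> f x"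
    and xy: "x \<in> V" "y \<in> V" "0 < A x y" "0 < f y"
  shows "0 < f x"
proof -
  have "0 < A x y * f y"
    using xy by simp
  also have "\<dots> \<le> mat_vec V A f x"
    unfolding mat_vec_def using xy(1,2) f(2) nonneg finite_V
    by (intro member_le_sum) (auto intro: mult_nonneg_nonneg)
  also have "\<dots> = l * f x"
    using f(1) xy(1) by (simp add: eigenvector_def)
  finally show ?thesis
    using f(2)[of x] by (cases "f x = 0") auto
qed

end

section \<open>The signless Laplacian of a bipartite graph\<close>

lemma q_radius_eq_max_eigenvalue: "q_radius V E = max_eigenvalue V (signless_laplacian V E)"
  by (simp add: q_radius_def max_eigenvalue_def Q_eigenvalues_def eigenvalues_def eigenvector_def
      mat_vec_def)

lemma nonneg_symmetric_signless_laplacian: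
  assumes "finite V" "V \<noteq> {}"
  shows "nonneg_symmetric_matrix V (signless_laplacian V E)"
  using assms by unfold_locales (auto simp: signless_laplacian_def adj_sym)

lemma mat_vec_signless_laplacian:
  assumes "finite V" "x \<in> V"
  shows "mat_vec V (signless_laplacian V E) f x = (\<Sum>y\<in>nbhd V E x. f x + f y)"
proof -
  have "mat_vec V (signless_laplacian V E) f x =
      (\<Sum>y\<in>V. if x = y then real (degree V E x) * f y else 0) + (\<Sum>y\<in>V. if adj E x y then f y else 0)"
    unfolding mat_vec_def sum.distrib[symmetric]
    by (intro sum.cong) (auto simp: signless_laplacian_def algebra_simps)
  also have "\<dots> = degree V E x * f x + (\<Sum>y\<in>nbhd V E x. f y)"
    using assms by (simp add: nbhd_def sum.inter_filter)
  finally show ?thesis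
    by (simp add: sum.distrib card_nbhd)
qed

lemma q_radius_le_weighted:
  assumes "finite V" "V \<noteq> {}" "\<And>x. x \<in> V \<Longrightarrow> 0 < w x"
    and "\<And>x. x \<in> V \<Longrightarrow> (\<Sum>y\<in>nbhd V E x. w x + w y) \<le> l * w x"
  shows "q_radius V E \<le> l"
proof -
  interpret nonneg_symmetric_matrix V "signless_laplacian V E"
    using assms(1,2) by (rule nonneg_symmetric_signless_laplacian)
  show ?thesis
    unfolding q_radius_eq_max_eigenvalue
    using assms by (intro max_eigenvalue_le) (simp_all add: mat_vec_signless_laplacian)
qed

definition edge_energy :: "'a set \<Rightarrow> 'a set set \<Rightarrow> ('a \<Rightarrow> real) \<Rightarrow> 'a \<Rightarrow> real" where
  "edge_energy V E f y = (\<Sum>x\<in>nbhd V E y. (f x + f y)\<^sup>2)"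

lemma form_eq_sum_edge_energy:
  assumes bip: "bipartite_graph X Y E"
  shows "inprod (X \<union> Y) f (mat_vec (X \<union> Y) (signless_laplacian (X \<union> Y) E) f) =
    (\<Sum>y\<in>Y. edge_energy (X \<union> Y) E f y)"
proof -
  let ?N = "nbhd (X \<union> Y) E"
  note fin = bipartite_graphD[OF bip]
  have "inprod (X \<union> Y) f (mat_vec (X \<union> Y) (signless_laplacian (X \<union> Y) E) f) =
      (\<Sum>x\<in>X \<union> Y. \<Sum>y\<in>?N x. f x * (f x + f y))"
    unfolding inprod_def using fin by (simp add: mat_vec_signless_laplacian sum_distrib_left)
  also have "\<dots> = (\<Sum>x\<in>X. \<Sum>y\<in>?N x. f x * (f x + f y)) + (\<Sum>y\<in>Y. \<Sum>x\<in>?N y. f y * (f y + f x))"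
    by (rule sum.union_disjoint[OF fin])
  also have "\<dots> = (\<Sum>y\<in>Y. (\<Sum>x\<in>?N y. f x * (f x + f y)) + (\<Sum>x\<in>?N y. f y * (f y + f x)))"
    by (simp add: sum_nbhd_swap[OF bip] sum.distrib)
  also have "\<dots> = (\<Sum>y\<in>Y. edge_energy (X \<union> Y) E f y)"
    unfolding edge_energy_def sum.distrib[symmetric]
    by (intro sum.cong refl) (simp add: power2_eq_square algebra_simps)
  finally show ?thesis .
qed

lemma sum_edge_energy_le:
  assumes bip: "bipartite_graph X Y E" and "X \<union> Y \<noteq> {}"
  shows "(\<Sum>y\<in>Y. edge_energy (X \<union> Y) E f y) \<le> q_radius (X \<union> Y) E * inprod (X \<union> Y) f f"
proof -
  interpret nonneg_symmetric_matrix "X \<union> Y" "signless_laplacian (X \<union> Y) E"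
    using bipartite_graphD[OF bip] assms(2) by (intro nonneg_symmetric_signless_laplacian) auto
  show ?thesis
    using form_le[of f] by (simp add: form_eq_sum_edge_energy[OF bip] q_radius_eq_max_eigenvalue)
qed

lemma degree_weight_row_bound:
  fixes d S n e :: real
  assumes "0 \<le> d" "d \<le> n" "0 < n" "S \<le> e" "S \<le> n * d"
  shows "d * d + S \<le> (n + e / n) * d"
proof (cases "n * d \<le> e")
  case True
  then have "d \<le> e / n"
    using assms by (simp add: field_simps)
  then have "d * d \<le> e / n * d"
    using assms by (intro mult_right_mono)
  then show ?thesis
    using assms by (simp add: algebra_simps)
next
  case False
  then have "e / n \<le> d"
    using assms by (simp add: field_simps)
  then have "0 \<le> (n - d) * (d - e / n)"
    using assms by simp
  also have "\<dots> = (n + e / n) * d - d * d - e"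
    using assms by (simp add: field_simps)
  finally show ?thesis
    using assms by simp
qed

lemma q_radius_le_edges:
  assumes bip: "bipartite_graph X Y E" and card: "card X = n" "card Y = n" and n: "0 < n"
    and pos: "\<And>v. v \<in> X \<union> Y \<Longrightarrow> 0 < degree (X \<union> Y) E v"
  shows "q_radius (X \<union> Y) E \<le> n + card (adj_pairs X Y E) / n"
proof (rule q_radius_le_weighted)
  let ?d = "degree (X \<union> Y) E" and ?N = "nbhd (X \<union> Y) E"
  note fin = bipartite_graphD[OF bip]
  show "finite (X \<union> Y)" "X \<union> Y \<noteq> {}"
    using fin card n by auto
  fix v assume v: "v \<in> X \<union> Y"
  show "0 < real (?d v)"
    using pos[OF v] by simp
  have N: "?N w \<subseteq> X \<or> ?N w \<subseteq> Y" if "w \<in> X \<union> Y" for w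
    using that by (auto simp: nbhd_bipartite[OF bip])
  have d_le: "?d w \<le> n" if "w \<in> X \<union> Y" for w
    using N[OF that] card_mono[of X "?N w"] card_mono[of Y "?N w"] fin card by (auto simp: card_nbhd)
  have "(\<Sum>w\<in>?N v. ?d w) \<le> card (adj_pairs X Y E)"
    using N[OF v] sum_mono2[of X "?N v" ?d] sum_mono2[of Y "?N v" ?d] fin sum_degree[OF bip] by auto
  then have "(\<Sum>w\<in>?N v. real (?d w)) \<le> card (adj_pairs X Y E)"
    by (metis of_nat_le_iff of_nat_sum)
  moreover have "(\<Sum>w\<in>?N v. real (?d w)) \<le> (\<Sum>w\<in>?N v. real n)"
    using d_le by (intro sum_mono) (simp add: in_nbhd)
  ultimately have "real (?d v) * ?d v + (\<Sum>w\<in>?N v. real (?d w)) \<le>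
      (n + card (adj_pairs X Y E) / n) * ?d v"
    using d_le[OF v] n by (intro degree_weight_row_bound) (simp_all add: card_nbhd mult.commute)
  then show "(\<Sum>w\<in>?N v. real (?d v) + ?d w) \<le> (n + card (adj_pairs X Y E) / n) * ?d v"
    by (simp add: sum.distrib card_nbhd)
qed

text \<open>An approximate Perron vector of the graph in which every edge not incident with x0 and y0 is
  present.\<close>

definition cross_weight :: "'a set set \<Rightarrow> 'a \<Rightarrow> 'a \<Rightarrow> real \<Rightarrow> real \<Rightarrow> 'a \<Rightarrow> real" where
  "cross_weight E x0 y0 z c v =
     (if v = x0 \<or> v = y0 then z else if adj E v x0 \<or> adj E v y0 then c else 1)"

lemma cross_weight_commute: "cross_weight E x0 y0 = cross_weight E y0 x0"
  by (auto simp: cross_weight_def fun_eq_iff)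

lemma cross_weight_opposite:
  assumes bip: "bipartite_graph X Y E" and xy: "x0 \<in> X" "y0 \<in> Y" and y: "y \<in> Y"
  shows "cross_weight E x0 y0 z c y =
    (if y = y0 then z else if y \<in> nbhd (X \<union> Y) E x0 then c else 1)"
proof -
  have "\<not> adj E y y0" "y \<noteq> x0"
    using bipartite_graph_adj_iff(2)[OF bip, of y y0] bipartite_graphD(3)[OF bip] xy y by auto
  then show ?thesis
    using xy(1) y by (simp add: cross_weight_def nbhd_bipartite[OF bip] adj_sym[of E y])
qed

lemma sum_cross_weight_le:
  assumes bip: "bipartite_graph X Y E" and n: "card Y = n"
    and xy: "x0 \<in> X" "y0 \<in> Y" "adj E x0 y0" and deg: "degree (X \<union> Y) E x0 \<le> k" and c: "1 \<le> c"
  shows "(\<Sum>y\<in>Y - {y0}. cross_weight E x0 y0 z c y) \<le> (real k - 1) * c + (real n - k)"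
proof -
  define B where "B = nbhd (X \<union> Y) E x0 - {y0}"
  note fin = bipartite_graphD[OF bip]
  have B: "B \<subseteq> Y - {y0}" "y0 \<in> nbhd (X \<union> Y) E x0"
    using xy by (auto simp: B_def nbhd_bipartite[OF bip])
  then have "card B + 1 = degree (X \<union> Y) E x0"
    using fin card_Suc_Diff1[of "nbhd (X \<union> Y) E x0" y0] by (simp add: B_def finite_nbhd card_nbhd)
  then have card_B: "real (card B) \<le> real k - 1"
    using deg by linarith
  have "real (card (Y - {y0})) = real n - 1"
    using card_Suc_Diff1[OF fin(2) xy(2)] n by linarith
  moreover have "(\<Sum>y\<in>Y - {y0}. if y \<in> B then c - 1 else 0) = (\<Sum>y\<in>(Y - {y0}) \<inter> B. c - 1)"
    using fin by (intro sum.inter_restrict[symmetric]) simp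
  moreover have "(Y - {y0}) \<inter> B = B"
    using B(1) by blast
  moreover have "(\<Sum>y\<in>Y - {y0}. cross_weight E x0 y0 z c y) =
      (\<Sum>y\<in>Y - {y0}. 1 + (if y \<in> B then c - 1 else 0))"
    by (intro sum.cong) (auto simp: B_def cross_weight_opposite[OF bip xy(1,2)])
  ultimately have "(\<Sum>y\<in>Y - {y0}. cross_weight E x0 y0 z c y) = real n - 1 + card B * (c - 1)"
    by (simp add: sum.distrib)
  also have "\<dots> \<le> real n - 1 + (real k - 1) * (c - 1)"
    using card_B c by (intro add_left_mono mult_right_mono) auto
  finally show ?thesis
    by (simp add: algebra_simps)
qed

context
  fixes X Y :: "'a set" and E :: "'a set set" and x0 y0 x :: 'a and n k :: nat and c z l :: real
  assumes bip: "bipartite_graph X Y E" and n: "card Y = n"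
    and xy: "x0 \<in> X" "y0 \<in> Y" "adj E x0 y0" and deg: "degree (X \<union> Y) E x0 \<le> k" and x: "x \<in> X"
    and c: "1 \<le> c" and z: "0 < z"
begin

lemmas sum_weight_le = sum_cross_weight_le[OF bip n xy deg c, of z]
lemmas weight_opposite = cross_weight_opposite[OF bip xy(1,2), of _ z c]

lemma cross_weight_same_side:
  "cross_weight E x0 y0 z c x = (if x = x0 then z else if y0 \<in> nbhd (X \<union> Y) E x then c else 1)"
  using cross_weight_opposite[OF bipartite_graph_sym[OF bip] xy(2,1) x, of z c] x xy(2)
  by (auto simp: cross_weight_commute Un_commute nbhd_bipartite[OF bip])

lemma cross_weight_nonneg: "0 \<le> cross_weight E x0 y0 z c v"
  using c z by (simp add: cross_weight_def)

lemma nbhd_subset_opposite: "nbhd (X \<union> Y) E x \<subseteq> Y" "finite (nbhd (X \<union> Y) E x)"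
  using x bipartite_graphD[OF bip] by (auto simp: nbhd_bipartite[OF bip] finite_nbhd)

lemma cross_weight_row_low:
  assumes "x = x0" and row: "(real k + 1) * z + (real k - 1) * c \<le> l * z"
  shows "(\<Sum>y\<in>nbhd (X \<union> Y) E x. cross_weight E x0 y0 z c x + cross_weight E x0 y0 z c y) \<le>
    l * cross_weight E x0 y0 z c x"
proof -
  let ?w = "cross_weight E x0 y0 z c" and ?N = "nbhd (X \<union> Y) E x"
  have y0: "y0 \<in> ?N"
    using \<open>x = x0\<close> xy by (simp add: nbhd_bipartite[OF bip])
  have card: "real (card ?N) \<le> k" "real (card (?N - {y0})) = real (card ?N) - 1"
    using deg \<open>x = x0\<close> y0 card_Suc_Diff1[OF nbhd_subset_opposite(2) y0] by (auto simp: card_nbhd)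
  have w: "?w y0 = z" "?w x = z"
    using \<open>x = x0\<close> by (simp_all add: cross_weight_def)
  have "sum ?w (?N - {y0}) = (\<Sum>y\<in>?N - {y0}. c)"
    using nbhd_subset_opposite(1) \<open>x = x0\<close> by (intro sum.cong) (auto simp: weight_opposite)
  then have "(\<Sum>y\<in>?N. ?w x + ?w y) = card ?N * z + (z + (real (card ?N) - 1) * c)"
    using sum.remove[OF nbhd_subset_opposite(2) y0, of ?w] card(2) by (simp add: w sum.distrib)
  also have "\<dots> \<le> real k * z + (z + (real k - 1) * c)"
    using card(1) c z by (intro add_mono mult_right_mono) auto
  also have "\<dots> \<le> l * ?w x"
    using row by (simp add: w algebra_simps)
  finally show ?thesis .
qed

lemma cross_weight_row_adjacent:
  assumes "x \<noteq> x0" "y0 \<in> nbhd (X \<union> Y) E x"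
    and row: "real n * c + z + (real k - 1) * c + (real n - k) \<le> l * c"
  shows "(\<Sum>y\<in>nbhd (X \<union> Y) E x. cross_weight E x0 y0 z c x + cross_weight E x0 y0 z c y) \<le>
    l * cross_weight E x0 y0 z c x"
proof -
  let ?w = "cross_weight E x0 y0 z c"
  note fin = bipartite_graphD[OF bip]
  have w_x: "?w x = c"
    using assms(1,2) by (simp add: cross_weight_same_side)
  have "(\<Sum>y\<in>nbhd (X \<union> Y) E x. ?w x + ?w y) \<le> (\<Sum>y\<in>Y. c + ?w y)"
    unfolding w_x using nbhd_subset_opposite fin c cross_weight_nonneg
    by (intro sum_mono2) (auto intro: add_nonneg_nonneg)
  also have "\<dots> = n * c + z + sum ?w (Y - {y0})"
    using sum.remove[OF fin(2) xy(2), of ?w] n weight_opposite[OF xy(2)] by (simp add: sum.distrib)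
  also have "\<dots> \<le> l * ?w x"
    using sum_weight_le row by (simp add: w_x)
  finally show ?thesis .
qed

lemma cross_weight_row_rest:
  assumes "x \<noteq> x0" "y0 \<notin> nbhd (X \<union> Y) E x" and row: "2 * real n - k - 1 + (real k - 1) * c \<le> l"
  shows "(\<Sum>y\<in>nbhd (X \<union> Y) E x. cross_weight E x0 y0 z c x + cross_weight E x0 y0 z c y) \<le>
    l * cross_weight E x0 y0 z c x"
proof -
  let ?w = "cross_weight E x0 y0 z c"
  note fin = bipartite_graphD[OF bip]
  have w_x: "?w x = 1"
    using assms(1,2) by (simp add: cross_weight_same_side)
  have "(\<Sum>y\<in>nbhd (X \<union> Y) E x. ?w x + ?w y) \<le> (\<Sum>y\<in>Y - {y0}. 1 + ?w y)"
    unfolding w_x using nbhd_subset_opposite fin cross_weight_nonneg assms(2)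
    by (intro sum_mono2) (auto intro: add_nonneg_nonneg)
  also have "\<dots> = real (card (Y - {y0})) + sum ?w (Y - {y0})"
    by (simp add: sum.distrib)
  also have "real (card (Y - {y0})) = real n - 1"
    using card_Suc_Diff1[OF fin(2) xy(2)] n by linarith
  also have "real n - 1 + sum ?w (Y - {y0}) \<le> l * ?w x"
    using sum_weight_le row by (simp add: w_x)
  finally show ?thesis .
qed

lemma cross_weight_row:
  assumes "(real k + 1) * z + (real k - 1) * c \<le> l * z"
    and "real n * c + z + (real k - 1) * c + (real n - k) \<le> l * c"
    and "2 * real n - k - 1 + (real k - 1) * c \<le> l"
  shows "(\<Sum>y\<in>nbhd (X \<union> Y) E x. cross_weight E x0 y0 z c x + cross_weight E x0 y0 z c y) \<le>
    l * cross_weight E x0 y0 z c x"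
  using cross_weight_row_low[OF _ assms(1)] cross_weight_row_adjacent[OF _ _ assms(2)]
    cross_weight_row_rest[OF _ _ assms(3)] by blast

end

lemma cross_row_identity:
  fixes d k n :: real
  assumes "d > 0" "2 * n = d + k + 3"
  shows "(2 * n - 2 + 2 * (k - 1) / d) * ((d + 2) / d) -
    (n * ((d + 2) / d) + (k - 1) * (d + 2) / d\<^sup>2 + (k - 1) * ((d + 2) / d) + (n - k)) =
    2 * (k - 1) / d\<^sup>2"
proof -
  have n: "n = (d + k + 3) / 2"
    using assms(2) by simp
  show ?thesis
    unfolding n using assms(1) by (simp add: divide_simps power2_eq_square) (simp add: algebra_simps)
qed

lemma cross_row_bounds:
  fixes n k :: real
  assumes k: "1 < k" and d_pos: "0 < 2 * n - k - 3"
  defines "d \<equiv> 2 * n - k - 3"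
  defines "c \<equiv> (d + 2) / d" and "z \<equiv> (k - 1) * (d + 2) / d\<^sup>2" and "l \<equiv> 2 * n - 2 + 2 * (k - 1) / d"
  shows "1 \<le> c" "0 < z"
    "(k + 1) * z + (k - 1) * c \<le> l * z"
    "n * c + z + (k - 1) * c + (n - k) \<le> l * c"
    "2 * n - k - 1 + (k - 1) * c \<le> l"
proof -
  have d: "0 < d"
    using d_pos by (simp add: d_def)
  then show "1 \<le> c"
    by (simp add: c_def)
  show z: "0 < z"
    unfolding z_def using d k by simp
  have e: "0 \<le> 2 * (k - 1) / d"
    using d k by simp
  have zc: "z * d = (k - 1) * c"
    unfolding z_def c_def using d by (simp add: power2_eq_square)
  have l: "l = d + (k + 1) + 2 * (k - 1) / d"
    by (simp add: l_def d_def)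
  have "(k + 1) * z + (k - 1) * c = (k + 1 + d) * z"
    using zc by (simp add: algebra_simps)
  also have "\<dots> \<le> l * z"
    unfolding l using e z by (intro mult_right_mono) auto
  finally show "(k + 1) * z + (k - 1) * c \<le> l * z" .
  have "(k - 1) * c = (k - 1) + 2 * (k - 1) / d"
    using d by (simp add: c_def field_simps)
  then show "2 * n - k - 1 + (k - 1) * c \<le> l"
    by (simp add: l_def)
  have "l * c - (n * c + z + (k - 1) * c + (n - k)) = 2 * (k - 1) / d\<^sup>2"
    unfolding l_def c_def z_def by (rule cross_row_identity[OF d]) (simp add: d_def)
  moreover have "0 \<le> 2 * (k - 1) / d\<^sup>2"
    using k by simp
  ultimately show "n * c + z + (k - 1) * c + (n - k) \<le> l * c"
    by linarith
qed

lemma q_radius_le_low_edge: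
  assumes bip: "bipartite_graph X Y E" and card: "card X = n" "card Y = n"
    and n: "k + 3 < 2 * n" and k: "2 \<le> k"
    and xy: "x0 \<in> X" "y0 \<in> Y" "adj E x0 y0"
    and deg: "degree (X \<union> Y) E x0 \<le> k" "degree (X \<union> Y) E y0 \<le> k"
  shows "q_radius (X \<union> Y) E \<le> 2 * real n - 2 + 2 * (real k - 1) / (2 * real n - k - 3)"
proof -
  define d where "d = 2 * real n - k - 3"
  define c z l where "c = (d + 2) / d" and "z = (real k - 1) * (d + 2) / d\<^sup>2"
    and "l = 2 * real n - 2 + 2 * (real k - 1) / d"
  have "1 < real k" "0 < 2 * real n - k - 3"
    using n k by linarith+
  note bounds = cross_row_bounds[OF this, folded d_def, folded c_def z_def l_def]
  let ?w = "cross_weight E x0 y0 z c"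
  have "q_radius (X \<union> Y) E \<le> l"
  proof (rule q_radius_le_weighted)
    show "finite (X \<union> Y)" "X \<union> Y \<noteq> {}"
      using bipartite_graphD[OF bip] xy by auto
    show "0 < ?w v" for v
      using bounds(1,2) by (simp add: cross_weight_def)
    fix v assume "v \<in> X \<union> Y"
    then show "(\<Sum>y\<in>nbhd (X \<union> Y) E v. ?w v + ?w y) \<le> l * ?w v"
    proof
      assume "v \<in> X"
      show ?thesis
        by (rule cross_weight_row[OF bip card(2) xy deg(1) \<open>v \<in> X\<close> bounds])
    next
      assume "v \<in> Y"
      have "adj E y0 x0" "degree (Y \<union> X) E y0 \<le> k"
        using xy(3) deg(2) by (simp_all add: adj_sym Un_commute)
      from cross_weight_row[OF bipartite_graph_sym[OF bip] card(1) xy(2,1) this \<open>v \<in> Y\<close> bounds]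
      show ?thesis
        by (simp only: cross_weight_commute[of E y0] Un_commute[of Y])
    qed
  qed
  then show ?thesis
    by (simp add: l_def d_def)
qed

section \<open>The extremal graph\<close>

text \<open>The graph M on given vertex classes, with A for \<open>X2\<close> and T for \<open>Y2\<close>.\<close>

definition extremal_edges :: "'a set \<Rightarrow> 'a set \<Rightarrow> 'a set \<Rightarrow> 'a set \<Rightarrow> 'a set set" where
  "extremal_edges X Y A T = {{x, y} | x y. x \<in> X \<and> y \<in> Y \<and> (x \<in> A \<or> y \<notin> T)}"

lemma adj_extremal_edges:
  assumes "X \<inter> Y = {}" "x \<in> X" "y \<in> Y"
  shows "adj (extremal_edges X Y A T) x y \<longleftrightarrow> x \<in> A \<or> y \<notin> T"
  using assms by (auto simp: adj_def extremal_edges_def doubleton_eq_iff)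

lemma bipartite_graph_extremal_edges:
  assumes "finite X" "finite Y" "X \<inter> Y = {}"
  shows "bipartite_graph X Y (extremal_edges X Y A T)"
  using assms by (auto simp: bipartite_graph_def extremal_edges_def)

lemma graph_iso_bipartiteI:
  assumes bip: "bipartite_graph X Y E" "bipartite_graph X' Y' E'"
    and f: "bij_betw f X X'" and g: "bij_betw g Y Y'"
    and adj: "\<And>x y. x \<in> X \<Longrightarrow> y \<in> Y \<Longrightarrow> adj E' (f x) (g y) \<longleftrightarrow> adj E x y"
  shows "graph_iso (X \<union> Y) E (X' \<union> Y') E'"
proof -
  define h where "h v = (if v \<in> X then f v else g v)" for v
  note disj = bipartite_graphD(3)[OF bip(1)] bipartite_graphD(3)[OF bip(2)]
  have h_Y: "h y = g y" if "y \<in> Y" for y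
    using that disj(1) by (auto simp: h_def)
  have "bij_betw h X X'" "bij_betw h Y Y'"
    using f g h_Y by (simp_all add: h_def cong: bij_betw_cong)
  then have "bij_betw h (X \<union> Y) (X' \<union> Y')"
    using disj(2) by (rule bij_betw_combine)
  moreover have "h x \<in> X'" if "x \<in> X" for x
    using bij_betwE[OF f] that by (simp add: h_def)
  moreover have "h y \<in> Y'" if "y \<in> Y" for y
    using bij_betwE[OF g] that by (simp add: h_Y)
  moreover have "adj E x y \<longleftrightarrow> adj E' (h x) (h y)" if "x \<in> X" "y \<in> Y" for x y
    using adj[OF that] that by (simp add: h_Y) (simp add: h_def)
  ultimately have "\<forall>x\<in>X \<union> Y. \<forall>y\<in>X \<union> Y. adj E x y \<longleftrightarrow> adj E' (h x) (h y)"
    using bipartite_graph_adj_iff[OF bip(1)] bipartite_graph_adj_iff[OF bip(2)] adj_sym by (metis UnE)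
  with \<open>bij_betw h (X \<union> Y) (X' \<union> Y')\<close> show ?thesis
    unfolding graph_iso_def by blast
qed

lemma ex_bij_betw_mapping_subset:
  assumes fin: "finite X" "finite X'" and card: "card X = card X'" "card A = card A'"
    and sub: "A \<subseteq> X" "A' \<subseteq> X'"
  obtains h where "bij_betw h X X'" "\<And>x. x \<in> X \<Longrightarrow> h x \<in> A' \<longleftrightarrow> x \<in> A"
proof -
  have finA: "finite A" "finite A'"
    using fin sub finite_subset by blast+
  obtain f where f: "bij_betw f A A'"
    using finite_same_card_bij[OF finA card(2)] by blast
  have "card (X - A) = card (X' - A')"
    using card sub finA by (simp add: card_Diff_subset)
  then obtain g where g: "bij_betw g (X - A) (X' - A')"
    using finite_same_card_bij[of "X - A" "X' - A'"] fin by blast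
  let ?h = "\<lambda>x. if x \<in> A then f x else g x"
  have "bij_betw ?h (A \<union> (X - A)) (A' \<union> (X' - A'))"
    by (rule bij_betw_disjoint_Un[OF f g]) auto
  moreover have "A \<union> (X - A) = X" "A' \<union> (X' - A') = X'"
    using sub by auto
  moreover have "?h x \<in> A' \<longleftrightarrow> x \<in> A" if "x \<in> X" for x
    using bij_betwE[OF f] bij_betwE[OF g] that by auto
  ultimately show thesis
    using that[of ?h] by simp
qed

lemma graph_iso_extremal_edges:
  assumes "finite X" "finite Y" "X \<inter> Y = {}" "finite X'" "finite Y'" "X' \<inter> Y' = {}"
    and card: "card X = card X'" "card Y = card Y'" "card A = card A'" "card T = card T'"
    and sub: "A \<subseteq> X" "A' \<subseteq> X'" "T \<subseteq> Y" "T' \<subseteq> Y'"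
  shows "graph_iso (X \<union> Y) (extremal_edges X Y A T) (X' \<union> Y') (extremal_edges X' Y' A' T')"
proof -
  obtain f where f: "bij_betw f X X'" "\<And>x. x \<in> X \<Longrightarrow> f x \<in> A' \<longleftrightarrow> x \<in> A"
    using ex_bij_betw_mapping_subset[OF _ _ card(1,3) sub(1,2)] assms by blast
  obtain g where g: "bij_betw g Y Y'" "\<And>y. y \<in> Y \<Longrightarrow> g y \<in> T' \<longleftrightarrow> y \<in> T"
    using ex_bij_betw_mapping_subset[OF _ _ card(2,4) sub(3,4)] assms by blast
  show ?thesis
    using f g bij_betwE[OF f(1)] bij_betwE[OF g(1)] assms
    by (intro graph_iso_bipartiteI[where f = f and g = g] bipartite_graph_extremal_edges)
      (auto simp: adj_extremal_edges)
qed

lemma card_Pair_image: "card (Pair a ` S) = card S"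
  by (simp add: card_image inj_on_def)

lemma M_X_eq_image: "M_X n = Pair 0 ` {..<n}" and M_Y_eq_image: "M_Y n = Pair 1 ` {..<n}"
  by (auto simp: M_X_def M_Y_def)

lemma M_E_eq_extremal_edges:
  "M_E n m (n - k) t = extremal_edges (M_X n) (M_Y m) (Pair 0 ` {n - k..<n}) (Pair 1 ` {m - t..<m})"
proof -
  have "{(0, i), (1, j)} \<in>
      extremal_edges (M_X n) (M_Y m) (Pair 0 ` {n - k..<n}) (Pair 1 ` {m - t..<m}) \<longleftrightarrow>
    n - k \<le> i \<or> j < m - t" if "i < n" "j < m" for i j
    using that by (auto simp: extremal_edges_def M_X_def M_Y_def doubleton_eq_iff)
  then show ?thesis
    by (fastforce simp: M_E_def extremal_edges_def M_X_def M_Y_def)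
qed

lemma graph_iso_extremal_edges_M:
  assumes "finite X" "finite Y" "X \<inter> Y = {}" "card X = n" "card Y = n"
    and "A \<subseteq> X" "card A = k" "T \<subseteq> Y" "card T = t"
  shows "graph_iso (X \<union> Y) (extremal_edges X Y A T) (M_X n \<union> M_Y n) (M_E n n (n - k) t)"
proof -
  have "k \<le> n" "t \<le> n"
    using card_mono[OF assms(1,6)] card_mono[OF assms(2,8)] assms by auto
  then show ?thesis
    unfolding M_E_eq_extremal_edges using assms
    by (intro graph_iso_extremal_edges) (auto simp: M_X_eq_image M_Y_eq_image card_Pair_image)
qed

lemma graph_iso_sym:
  assumes "graph_iso V E V' E'"
  shows "graph_iso V' E' V E"
proof -
  obtain f where f: "bij_betw f V V'" "\<forall>x\<in>V. \<forall>y\<in>V. adj E x y \<longleftrightarrow> adj E' (f x) (f y)"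
    using assms unfolding graph_iso_def by blast
  have "bij_betw (inv_into V f) V' V"
    using f(1) by (rule bij_betw_inv_into)
  moreover from this have "\<forall>x\<in>V'. \<forall>y\<in>V'. adj E' x y \<longleftrightarrow> adj E (inv_into V f x) (inv_into V f y)"
    using f(2) bij_betw_inv_into_right[OF f(1)] bij_betwE by metis
  ultimately show ?thesis
    unfolding graph_iso_def by blast
qed

lemma Q_eigenvalues_subset_if_graph_iso:
  assumes "graph_iso V E V' E'"
  shows "Q_eigenvalues V' E' \<subseteq> Q_eigenvalues V E"
proof
  fix l assume "l \<in> Q_eigenvalues V' E'"
  then obtain v where v: "\<exists>x\<in>V'. v x \<noteq> 0"
    "\<And>x. x \<in> V' \<Longrightarrow> (\<Sum>y\<in>V'. signless_laplacian V' E' x y * v y) = l * v x"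
    unfolding Q_eigenvalues_def by blast
  obtain f where f: "bij_betw f V V'" and adj: "\<And>x y. x \<in> V \<Longrightarrow> y \<in> V \<Longrightarrow> adj E' (f x) (f y) \<longleftrightarrow> adj E x y"
    using assms unfolding graph_iso_def by metis
  have inj: "inj_on f V" and im: "f ` V = V'"
    using f by (auto simp: bij_betw_def)
  have deg: "degree V' E' (f x) = degree V E x" if "x \<in> V" for x
  proof -
    have "{y \<in> V'. adj E' (f x) y} = f ` {y \<in> V. adj E x y}"
      using im adj that by auto
    moreover have "inj_on f {y \<in> V. adj E x y}"
      using inj by (rule inj_on_subset) auto
    ultimately show ?thesis
      by (simp add: degree_def card_image)
  qed
  have Q: "signless_laplacian V' E' (f x) (f y) = signless_laplacian V E x y" if "x \<in> V" "y \<in> V" for x y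
    using that deg adj inj by (auto simp: signless_laplacian_def inj_on_eq_iff)
  have "(\<Sum>y\<in>V. signless_laplacian V E x y * v (f y)) = l * v (f x)" if "x \<in> V" for x
  proof -
    have "(\<Sum>y\<in>V. signless_laplacian V E x y * v (f y)) =
        (\<Sum>y\<in>V. signless_laplacian V' E' (f x) (f y) * v (f y))"
      using Q that by (intro sum.cong) auto
    also have "\<dots> = (\<Sum>y\<in>V'. signless_laplacian V' E' (f x) y * v y)"
      unfolding im[symmetric] by (simp add: sum.reindex[OF inj])
    finally show ?thesis
      using v(2) im that by auto
  qed
  moreover have "\<exists>x\<in>V. v (f x) \<noteq> 0"
    using v(1) im by auto
  ultimately show "l \<in> Q_eigenvalues V E"
    unfolding Q_eigenvalues_def by (intro CollectI exI[of _ "\<lambda>x. v (f x)"]) auto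
qed

lemma q_radius_eq_if_graph_iso: "graph_iso V E V' E' \<Longrightarrow> q_radius V E = q_radius V' E'"
  using Q_eigenvalues_subset_if_graph_iso graph_iso_sym by (metis q_radius_def subset_antisym)

subsection \<open>Test vectors\<close>

locale extremal_bigraph =
  fixes X Y A T :: "'a set"
  assumes finite_X [simp]: "finite X" and finite_Y [simp]: "finite Y" and disjoint: "X \<inter> Y = {}"
    and A_subset: "A \<subseteq> X" and T_subset: "T \<subseteq> Y"
begin

abbreviation V :: "'a set" where "V \<equiv> X \<union> Y"
abbreviation M :: "'a set set" where "M \<equiv> extremal_edges X Y A T"

lemma bipartite_M: "bipartite_graph X Y M"
  by (rule bipartite_graph_extremal_edges[OF finite_X finite_Y disjoint])

lemma finite_T [simp]: "finite T"
  using T_subset finite_Y by (rule finite_subset)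

lemma nbhd_M_X: "x \<in> X \<Longrightarrow> nbhd V M x = (if x \<in> A then Y else Y - T)"
  and nbhd_M_Y: "y \<in> Y \<Longrightarrow> nbhd V M y = (if y \<in> T then A else X)"
  using A_subset by (auto simp: nbhd_bipartite[OF bipartite_M] adj_extremal_edges[OF disjoint])

lemma sum_Y_split: "sum h Y = sum h T + sum h (Y - T)" for h :: "'a \<Rightarrow> real"
  using sum.subset_diff[OF T_subset finite_Y, of h] by simp

lemma q_radius_extremal_test_vector:
  fixes a b z :: real
  assumes "X \<noteq> {}"
  shows "real (card X) * card (Y - T) * (a + b)\<^sup>2 + real (card A) * card T * (a + z)\<^sup>2 \<le>
    q_radius V M * (card X * a\<^sup>2 + card (Y - T) * b\<^sup>2 + card T * z\<^sup>2)"
proof -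
  define f where "f v = (if v \<in> X then a else if v \<in> T then z else b)" for v
  have f_X: "f x = a" if "x \<in> X" for x
    using that by (simp add: f_def)
  have f_Y: "f y = (if y \<in> T then z else b)" if "y \<in> Y" for y
    using that disjoint by (auto simp: f_def)
  have "edge_energy V M f y = (if y \<in> T then card A * (a + z)\<^sup>2 else card X * (a + b)\<^sup>2)"
    if "y \<in> Y" for y
    using A_subset that by (simp add: edge_energy_def nbhd_M_Y f_X f_Y subset_iff)
  then have "(\<Sum>y\<in>Y. edge_energy V M f y) =
      card T * (card A * (a + z)\<^sup>2) + card (Y - T) * (card X * (a + b)\<^sup>2)"
    using T_subset by (simp add: sum_Y_split subset_iff)
  moreover have "inprod V f f = card X * a\<^sup>2 + card (Y - T) * b\<^sup>2 + card T * z\<^sup>2"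
    using T_subset f_X f_Y
    by (simp add: inprod_def sum.union_disjoint[OF finite_X finite_Y disjoint] sum_Y_split subset_iff
        power2_eq_square)
  ultimately show ?thesis
    using sum_edge_energy_le[OF bipartite_M, of f] assms by (simp add: mult_ac)
qed

end

abbreviation (input) q_M :: "nat \<Rightarrow> nat \<Rightarrow> nat \<Rightarrow> real" where
  "q_M n k t \<equiv> q_radius (M_X n \<union> M_Y n) (M_E n n (n - k) t)"

lemma q_radius_M_test_vector:
  fixes n k t :: nat and z :: real
  assumes n: "0 < n" "k \<le> n" "t \<le> n"
  defines "P \<equiv> real n * (real n - t) * (2 * real n - t)"
  shows "(2 * real n - t) * P + real k * t * (real n - t + z)\<^sup>2 \<le>
    q_M n k t * (P + t * z\<^sup>2)"
proof -
  interpret extremal_bigraph "M_X n" "M_Y n" "Pair 0 ` {n - k..<n}" "Pair 1 ` {n - t..<n}"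
    by unfold_locales (auto simp: M_X_eq_image M_Y_eq_image)
  have "card (M_Y n - Pair 1 ` {n - t..<n}) = card (M_Y n) - card (Pair (1 :: nat) ` {n - t..<n})"
    using T_subset by (intro card_Diff_subset) auto
  moreover have "M_X n \<noteq> {}"
    using n by (auto simp: M_X_eq_image M_Y_eq_image)
  ultimately have "real n * (real n - t) * (real n - t + n)\<^sup>2 + real k * t * (real n - t + z)\<^sup>2 \<le>
    q_radius V M * (n * (real n - t)\<^sup>2 + (real n - t) * (real n)\<^sup>2 + t * z\<^sup>2)"
    using q_radius_extremal_test_vector[of "real n - t" "real n" z] n(2,3)
    by (simp add: M_X_eq_image M_Y_eq_image card_Pair_image of_nat_diff)
  moreover have "real n * (real n - t) * (real n - t + n)\<^sup>2 = (2 * real n - t) * P"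
    "n * (real n - t)\<^sup>2 + (real n - t) * (real n)\<^sup>2 = P"
    by (simp_all add: P_def power2_eq_square algebra_simps)
  ultimately show ?thesis
    by (simp add: M_E_eq_extremal_edges)
qed

lemma q_radius_M_gt:
  fixes n k t :: nat
  assumes "0 < k" "k \<le> n" "0 < t" "t < n"
  shows "2 * real n - t < q_M n k t" (is "_ < ?q")
proof -
  define P where "P = real n * (real n - t) * (2 * real n - t)"
  have P: "0 < P"
    unfolding P_def using assms by simp
  have "0 < real k * t * (real n - t)\<^sup>2"
    using assms by simp
  moreover have "(2 * real n - t) * P + real k * t * (real n - t)\<^sup>2 \<le> ?q * P"
    using q_radius_M_test_vector[of n k t 0] assms by (simp add: P_def)
  ultimately have "(2 * real n - t) * P < ?q * P"
    by linarith
  then show ?thesis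
    using P by simp
qed

lemma test_vector_two_core:
  fixes n k r :: real
  assumes n: "3 * (k + 2) \<le> n" and k: "2 \<le> k" and r: "0 \<le> r" "r \<le> 1 / 5"
  shows "(k - 1) * (2 * n * (n - 1) + 2 * r\<^sup>2 * (n - 2)) < (n - 2) * k * (2 * n - 3 - r)"
proof -
  have "r\<^sup>2 \<le> (1 / 5)\<^sup>2"
    using r by (intro power_mono)
  then have "2 * r\<^sup>2 * (n - 2) \<le> 2 * (1 / 25) * (n - 2)"
    using n k by (intro mult_right_mono) (auto simp: power2_eq_square)
  then have "(k - 1) * (2 * n * (n - 1) + 2 * r\<^sup>2 * (n - 2)) \<le>
      (k - 1) * (2 * n * (n - 1) + 2 / 25 * (n - 2))"
    using k by (intro mult_left_mono) auto
  also have "\<dots> =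
      2 * (k * (n * n)) - 48 / 25 * (k * n) - 4 / 25 * k - 2 * (n * n) + 48 / 25 * n + 4 / 25"
    by (simp add: field_simps)
  also have "\<dots> < 2 * (k * (n * n)) - 36 / 5 * (k * n) + 32 / 5 * k"
  proof -
    have "n * (6 * k + 12) \<le> n * (2 * n)"
      using n k by (intro mult_left_mono) auto
    then have "6 * (k * n) + 12 * n \<le> 2 * (n * n)"
      by (simp add: algebra_simps)
    moreover have "0 \<le> k * n" "12 \<le> n"
      using n k by auto
    ultimately show ?thesis
      using k by linarith
  qed
  also have "\<dots> = (n - 2) * k * (2 * n - 3 - 1 / 5)"
    by (simp add: field_simps)
  also have "\<dots> \<le> (n - 2) * k * (2 * n - 3 - r)"
    using r n k by (intro mult_left_mono) auto
  finally show ?thesis .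
qed

text \<open>The entry z = r (n - 2) on \<open>Y2\<close> maximises the quadratic k (n - 2 + z)^2 - (2 n - 2) z^2.\<close>

lemma test_vector_two_gap:
  fixes n k q :: real
  assumes n: "3 * (k + 2) \<le> n" and k: "2 \<le> k"
  defines "P \<equiv> n * (n - 2) * (2 * n - 2)"
  assumes test: "\<And>z. (2 * n - 2) * P + k * 2 * (n - 2 + z)\<^sup>2 \<le> q * (P + 2 * z\<^sup>2)"
  shows "2 * n - 2 + 2 * (k - 1) / (2 * n - k - 3) < q"
proof -
  define D where "D = 2 * n - 2 - k"
  define r where "r = k / D"
  define e where "e = 2 * (k - 1) / (D - 1)"
  define S where "S = 2 * n * (n - 1) + 2 * r\<^sup>2 * (n - 2)"
  have D: "1 < D" "5 * k \<le> D"
    using n k by (auto simp: D_def)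
  have r: "r * D = k" "0 \<le> r" "r \<le> 1 / 5"
    using D k by (auto simp: r_def field_simps)
  have n2: "0 < n - 2"
    using n k by simp
  have "e * S * (D - 1) = 2 * ((k - 1) * S)"
    using D(1) by (simp add: e_def)
  also have "\<dots> < 2 * ((n - 2) * k * (2 * n - 3 - r))"
    unfolding S_def using test_vector_two_core[OF n k r(2,3)] by simp
  also have "2 * n - 3 - r = (1 + r) * (D - 1)"
    using r(1) by (simp add: D_def algebra_simps)
  finally have "e * S * (D - 1) < 2 * (n - 2) * (k * (1 + r)) * (D - 1)"
    by (simp only: mult.assoc)
  then have "e * S < 2 * (n - 2) * (k * (1 + r))"
    using D(1) by simp
  then have "(n - 2) * (e * S) < (n - 2) * (2 * (n - 2) * (k * (1 + r)))"
    using n2 by (rule mult_strict_left_mono)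
  also have "k * (1 + r) = k * (1 + r)\<^sup>2 - (D + k) * r\<^sup>2"
    unfolding r(1)[symmetric] by (simp add: power2_eq_square algebra_simps)
  finally have "(2 * n - 2 + e) * (P + 2 * (r * (n - 2))\<^sup>2) <
      (2 * n - 2) * P + k * 2 * (n - 2 + r * (n - 2))\<^sup>2"
    by (simp add: P_def S_def D_def power2_eq_square algebra_simps)
  also have "\<dots> \<le> q * (P + 2 * (r * (n - 2))\<^sup>2)"
    by (rule test)
  finally have "2 * n - 2 + e < q"
    using n k by (simp add: P_def mult_less_cancel_right)
  then show ?thesis
    by (simp add: e_def D_def algebra_simps)
qed

lemma q_radius_M_two_gt:
  fixes n k :: nat
  assumes n: "3 * (k + 2) \<le> n" and k: "2 \<le> k"
  shows "2 * real n - 2 + 2 * (real k - 1) / (2 * real n - k - 3) <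
    q_M n k 2"
proof (rule test_vector_two_gap)
  show "3 * (real k + 2) \<le> real n" "2 \<le> real k"
    using of_nat_mono[OF n, where ?'a = real] k by simp_all
  show "(2 * real n - 2) * (real n * (real n - 2) * (2 * real n - 2)) +
      real k * 2 * (real n - 2 + z)\<^sup>2 \<le>
    q_M n k 2 * (real n * (real n - 2) * (2 * real n - 2) + 2 * z\<^sup>2)" for z
    using q_radius_M_test_vector[of n k 2 z] n k by simp
qed

subsection \<open>Shifting neighbourhoods onto large Perron entries\<close>

lemma ex_top_subset:
  fixes f :: "'a \<Rightarrow> real"
  assumes "finite X" "k \<le> card X"
  shows "\<exists>A\<subseteq>X. card A = k \<and> (\<forall>a\<in>A. \<forall>b\<in>X - A. f b \<le> f a)"
  using assms(2)
proof (induction k)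
  case 0
  then show ?case
    by (intro exI[of _ "{}"]) auto
next
  case (Suc k)
  then obtain A where A: "A \<subseteq> X" "card A = k" "\<forall>a\<in>A. \<forall>b\<in>X - A. f b \<le> f a"
    by auto
  have "finite A"
    using A(1) assms(1) by (rule finite_subset)
  then have "X - A \<noteq> {}"
    using A Suc.prems card_mono[of A X] by auto
  then obtain z where z: "z \<in> X - A" "f z = (MAX x\<in>X - A. f x)"
    using assms(1) obtains_MAX[of "X - A" f] by (metis finite_Diff)
  have "f b \<le> f z" if "b \<in> X - A" for b
    unfolding z(2) using assms(1) that by simp
  then show ?case
    using A z(1) \<open>finite A\<close> by (intro exI[of _ "insert z A"]) auto
qed

lemma sum_diff_eq_threshold:
  fixes h :: "'a \<Rightarrow> real"
  assumes "finite A" "finite N"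
  shows "sum h A - sum h N = (\<Sum>a\<in>A - N. h a - c) + (\<Sum>b\<in>N - A. c - h b) + c * (real (card A) - card N)"
proof -
  have "sum h A = sum h (A \<inter> N) + sum h (A - N)" "sum h N = sum h (A \<inter> N) + sum h (N - A)"
    using assms sum.Int_Diff[of A h N] sum.Int_Diff[of N h A] by (simp_all add: Int_commute)
  moreover have "card A = card (A \<inter> N) + card (A - N)" "card N = card (A \<inter> N) + card (N - A)"
    using assms card_Int_Diff[of A N] card_Int_Diff[of N A] by (simp_all add: Int_commute)
  ultimately show ?thesis
    by (simp add: sum_subtractf algebra_simps)
qed

lemma sum_le_top_subset:
  fixes h :: "'a \<Rightarrow> real"
  assumes fin: "finite A" "finite N" and card: "card N \<le> card A"
    and top: "\<And>a b. a \<in> A \<Longrightarrow> b \<in> N - A \<Longrightarrow> h b \<le> h a" and nonneg: "\<And>a. a \<in> A \<Longrightarrow> 0 \<le> h a"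
  shows "sum h N \<le> sum h A"
proof (cases "A = {}")
  case False
  then obtain a where a: "a \<in> A" "h a = (MIN x\<in>A. h x)"
    using fin(1) by (metis obtains_MIN)
  then have min: "h a \<le> h x" if "x \<in> A" for x
    using fin(1) that by simp
  have "0 \<le> (\<Sum>x\<in>A - N. h x - h a) + (\<Sum>b\<in>N - A. h a - h b) + h a * (real (card A) - card N)"
    using min top a(1) nonneg card by (intro add_nonneg_nonneg sum_nonneg mult_nonneg_nonneg) auto
  then show ?thesis
    using sum_diff_eq_threshold[OF fin, of h "h a"] by simp
qed (use assms in auto)

lemma sum_less_top_subset:
  fixes h :: "'a \<Rightarrow> real"
  assumes fin: "finite A" "finite N" and card: "card N \<le> card A" and neq: "N \<noteq> A"
    and top: "\<And>a b. a \<in> A \<Longrightarrow> b \<in> N - A \<Longrightarrow> h b < h a" and pos: "\<And>a. a \<in> A \<Longrightarrow> 0 < h a"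
  shows "sum h N < sum h A"
proof -
  have "A \<noteq> {}"
    using fin card neq by auto
  then obtain a where a: "a \<in> A" "h a = (MIN x\<in>A. h x)"
    using fin(1) by (metis obtains_MIN)
  then have min: "h a \<le> h x" if "x \<in> A" for x
    using fin(1) that by simp
  have nonneg: "0 \<le> (\<Sum>x\<in>A - N. h x - h a)" "0 \<le> h a * (real (card A) - card N)"
    using min a(1) pos[OF a(1)] card by (auto intro!: sum_nonneg mult_nonneg_nonneg)
  have "0 < (\<Sum>b\<in>N - A. h a - h b) + h a * (real (card A) - card N)"
  proof (cases "N - A = {}")
    case True
    then have "card N < card A"
      using fin neq by (intro psubset_card_mono) auto
    then show ?thesis
      unfolding True using pos[OF a(1)] by simp
  next
    case False
    then have "0 < (\<Sum>b\<in>N - A. h a - h b)"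
      using fin top[OF a(1)] by (intro sum_pos) auto
    with nonneg show ?thesis
      by simp
  qed
  with nonneg show ?thesis
    using sum_diff_eq_threshold[OF fin, of h "h a"] by simp
qed

context extremal_bigraph
begin

context
  fixes f :: "'a \<Rightarrow> real" and l :: real
  assumes eig: "eigenvector V (signless_laplacian V M) l f" and f_nonneg: "\<And>x. 0 \<le> f x"
    and A_nonempty: "A \<noteq> {}" and Y1_nonempty: "Y - T \<noteq> {}"
begin

lemma eigenvector_M_pos:
  assumes "v \<in> V"
  shows "0 < f v"
proof -
  interpret nonneg_symmetric_matrix V "signless_laplacian V M"
    using A_nonempty A_subset by (intro nonneg_symmetric_signless_laplacian) auto
  have step: "0 < f x" if "x \<in> V" "y \<in> nbhd V M x" "0 < f y" for x y
    using that nonneg_eigenvector_pos_if_neighbour_pos[OF eig f_nonneg, of x y]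
    by (auto simp: in_nbhd signless_laplacian_def add_nonneg_pos)
  obtain a y1 where a: "a \<in> A" "a \<in> X" and y1: "y1 \<in> Y" "y1 \<notin> T"
    using A_nonempty A_subset Y1_nonempty by blast
  obtain z where z: "z \<in> V" "0 < f z"
    using eig f_nonneg by (auto simp: eigenvector_def less_le)
  have "\<exists>x\<in>X. 0 < f x"
  proof (cases "z \<in> X")
    case False
    then show ?thesis
      using step[of a z] z a by (auto simp: nbhd_M_X)
  qed (use z in blast)
  then have "0 < f y1"
    using step[of y1] y1 by (auto simp: nbhd_M_Y)
  then have pos_X: "0 < f x" if "x \<in> X" for x
    using step[of x y1] that y1 by (auto simp: nbhd_M_X)
  then have "0 < f y" if "y \<in> Y" for y
    using step[of y a] that a by (auto simp: nbhd_M_Y)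
  with pos_X assms show ?thesis
    by blast
qed

lemma eigenvector_M_less:
  assumes T_nonempty: "T \<noteq> {}" and a: "a \<in> A" and b: "b \<in> X - A"
  shows "f b < f a"
proof -
  have row: "card (nbhd V M x) * f x + sum f (nbhd V M x) = l * f x" if "x \<in> V" for x
    using eig that mat_vec_signless_laplacian[of V x M f] by (simp add: eigenvector_def sum.distrib)
  have row_a: "(l - card Y) * f a = sum f Y" and row_b: "(l - card (Y - T)) * f b = sum f (Y - T)"
    using row[of a] row[of b] a b A_subset by (auto simp: nbhd_M_X algebra_simps)
  have "0 < sum f T"
    using T_nonempty T_subset eigenvector_M_pos by (intro sum_pos) auto
  then have less: "sum f (Y - T) < sum f Y"
    by (simp add: sum_Y_split)
  moreover have "0 \<le> sum f (Y - T)"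
    using f_nonneg by (simp add: sum_nonneg)
  ultimately have "0 < (l - card Y) * f a"
    using row_a by simp
  then have l: "0 < l - card Y"
    using f_nonneg[of a] by (simp add: zero_less_mult_iff)
  have "(l - card Y) * f b \<le> (l - card (Y - T)) * f b"
    using f_nonneg[of b] card_mono[of Y "Y - T"] by (intro mult_right_mono) auto
  then have "(l - card Y) * f b < (l - card Y) * f a"
    using row_a row_b less by simp
  with l show ?thesis
    by simp
qed

end

context
  fixes E :: "'a set set" and f :: "'a \<Rightarrow> real"
  assumes bip: "bipartite_graph X Y E" and f_nonneg: "\<And>x. 0 \<le> f x"
    and top: "\<And>a b. a \<in> A \<Longrightarrow> b \<in> X - A \<Longrightarrow> f b \<le> f a"
    and low: "\<And>y. y \<in> T \<Longrightarrow> degree V E y \<le> card A"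
begin

lemma nbhd_le_nbhd_M:
  assumes "y \<in> Y"
  shows "nbhd V E y \<subseteq> X" "card (nbhd V E y) \<le> card (nbhd V M y)"
    "finite (nbhd V E y)" "finite (nbhd V M y)"
proof -
  show "nbhd V E y \<subseteq> X"
    using assms by (auto simp: nbhd_bipartite[OF bip])
  then show "card (nbhd V E y) \<le> card (nbhd V M y)"
    using low[of y] assms by (auto simp: nbhd_M_Y card_mono simp flip: card_nbhd)
qed (simp_all add: finite_nbhd)

lemma edge_energy_le_M:
  assumes y: "y \<in> Y"
  shows "edge_energy V E f y \<le> edge_energy V M f y"
  unfolding edge_energy_def
proof (rule sum_le_top_subset)
  fix a b assume "a \<in> nbhd V M y" "b \<in> nbhd V E y - nbhd V M y"
  then have "f b \<le> f a"
    using top nbhd_le_nbhd_M(1)[OF y] y by (auto simp: nbhd_M_Y split: if_splits)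
  then show "(f b + f y)\<^sup>2 \<le> (f a + f y)\<^sup>2"
    using f_nonneg by (intro power_mono) auto
qed (use nbhd_le_nbhd_M[OF y] in auto)

lemma edge_energy_less_M:
  assumes y: "y \<in> Y" and neq: "nbhd V E y \<noteq> nbhd V M y"
    and less: "\<And>a b. a \<in> A \<Longrightarrow> b \<in> X - A \<Longrightarrow> f b < f a" and pos: "\<And>v. v \<in> V \<Longrightarrow> 0 < f v"
  shows "edge_energy V E f y < edge_energy V M f y"
  unfolding edge_energy_def
proof (rule sum_less_top_subset[OF _ _ _ neq])
  fix a b assume "a \<in> nbhd V M y" "b \<in> nbhd V E y - nbhd V M y"
  then have "f b < f a"
    using less nbhd_le_nbhd_M(1)[OF y] y by (auto simp: nbhd_M_Y split: if_splits)
  then show "(f b + f y)\<^sup>2 < (f a + f y)\<^sup>2"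
    using f_nonneg by (intro power_strict_mono) auto
next
  fix a assume "a \<in> nbhd V M y"
  then show "0 < (f a + f y)\<^sup>2"
    using pos[of a] pos[of y] y by (simp add: in_nbhd)
qed (use nbhd_le_nbhd_M[OF y] in auto)

lemma eigenvector_M_if_q_radius_ge:
  assumes eig: "eigenvector V (signless_laplacian V E) (q_radius V E) f"
    and q: "q_radius V M \<le> q_radius V E" and V: "V \<noteq> {}"
  shows "eigenvector V (signless_laplacian V M) (q_radius V M) f"
    and "(\<Sum>y\<in>Y. edge_energy V E f y) = (\<Sum>y\<in>Y. edge_energy V M f y)"
proof -
  let ?e = "edge_energy V"
  interpret M: nonneg_symmetric_matrix V "signless_laplacian V M"
    using V by (intro nonneg_symmetric_signless_laplacian) auto
  have "q_radius V M * inprod V f f \<le> q_radius V E * inprod V f f"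
    using q by (intro mult_right_mono inprod_self_nonneg)
  also have "\<dots> = (\<Sum>y\<in>Y. ?e E f y)"
    using inprod_eigenvector[OF eig, of f] by (simp add: form_eq_sum_edge_energy[OF bip])
  finally have E_ge: "q_radius V M * inprod V f f \<le> (\<Sum>y\<in>Y. ?e E f y)" .
  have E_le_M: "(\<Sum>y\<in>Y. ?e E f y) \<le> (\<Sum>y\<in>Y. ?e M f y)"
    by (intro sum_mono edge_energy_le_M)
  have M_le: "(\<Sum>y\<in>Y. ?e M f y) \<le> q_radius V M * inprod V f f"
    by (rule sum_edge_energy_le[OF bipartite_M V])
  show "(\<Sum>y\<in>Y. ?e E f y) = (\<Sum>y\<in>Y. ?e M f y)"
    using E_ge E_le_M M_le by simp
  show "eigenvector V (signless_laplacian V M) (q_radius V M) f"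
  proof (rule M.form_maximizer_eigenvector)
    show "M.form g \<le> q_radius V M * inprod V g g" for g
      using M.form_le by (simp add: q_radius_eq_max_eigenvalue)
    show "M.form f = q_radius V M * inprod V f f"
      using E_ge E_le_M M_le by (simp add: form_eq_sum_edge_energy[OF bipartite_M])
    show "\<exists>x\<in>V. f x \<noteq> 0"
      using eig by (simp add: eigenvector_def)
  qed
qed

lemma eq_M_if_q_radius_ge:
  assumes eig: "eigenvector V (signless_laplacian V E) (q_radius V E) f"
    and q: "q_radius V M \<le> q_radius V E" and ne: "A \<noteq> {}" "T \<noteq> {}" "Y - T \<noteq> {}"
  shows "E = M"
proof -
  have "V \<noteq> {}"
    using ne(3) by blast
  note attains = eigenvector_M_if_q_radius_ge[OF eig q this]
  note pos = eigenvector_M_pos[OF attains(1) f_nonneg ne(1,3)]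
    and less = eigenvector_M_less[OF attains(1) f_nonneg ne(1,3,2)]
  have nbhd_eq: "nbhd V E y = nbhd V M y" if "y \<in> Y" for y
  proof (rule ccontr)
    assume "nbhd V E y \<noteq> nbhd V M y"
    then have "edge_energy V E f y < edge_energy V M f y"
      using that less pos by (intro edge_energy_less_M)
    then have "(\<Sum>y\<in>Y. edge_energy V E f y) < (\<Sum>y\<in>Y. edge_energy V M f y)"
      using that edge_energy_le_M by (intro sum_strict_mono_ex1) auto
    with attains(2) show False
      by simp
  qed
  show "E = M"
  proof (rule bipartite_graph_edges_eqI[OF bip bipartite_M])
    fix x y assume "x \<in> X" "y \<in> Y"
    then show "adj E x y \<longleftrightarrow> adj M x y"
      using nbhd_eq[of y] adj_sym[of _ x y] in_nbhd[of x V] by blast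
  qed
qed

end

end

lemma graph_iso_M_if_low_side:
  assumes bip: "bipartite_graph X Y E" and card: "card X = n" "card Y = n"
    and T: "T \<subseteq> Y" "card T = t" "\<And>y. y \<in> T \<Longrightarrow> degree (X \<union> Y) E y \<le> k"
    and kt: "0 < k" "k \<le> n" "0 < t" "t < n"
    and q: "q_M n k t \<le> q_radius (X \<union> Y) E"
  shows "graph_iso (X \<union> Y) E (M_X n \<union> M_Y n) (M_E n n (n - k) t)"
proof -
  note fin = bipartite_graphD[OF bip]
  interpret E: nonneg_symmetric_matrix "X \<union> Y" "signless_laplacian (X \<union> Y) E"
    using fin card kt by (intro nonneg_symmetric_signless_laplacian) auto
  obtain f where f: "\<And>x. 0 \<le> f x"
    "eigenvector (X \<union> Y) (signless_laplacian (X \<union> Y) E) (q_radius (X \<union> Y) E) f"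
    using E.ex_nonneg_max_eigenvector by (metis q_radius_eq_max_eigenvalue)
  obtain A where A: "A \<subseteq> X" "card A = k" and top: "\<And>a b. a \<in> A \<Longrightarrow> b \<in> X - A \<Longrightarrow> f b \<le> f a"
    using ex_top_subset[OF fin(1), of k f] card kt by auto
  interpret extremal_bigraph X Y A T
    using fin A T by unfold_locales auto
  have iso: "graph_iso V M (M_X n \<union> M_Y n) (M_E n n (n - k) t)"
    by (rule graph_iso_extremal_edges_M[OF fin card A T(1,2)])
  have "E = M"
  proof (rule eq_M_if_q_radius_ge[OF bip f(1) top _ f(2)])
    show "degree V E y \<le> card A" if "y \<in> T" for y
      using T(3)[OF that] A(2) by simp
    show "q_radius V M \<le> q_radius V E"
      using q q_radius_eq_if_graph_iso[OF iso] by simp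
    show "A \<noteq> {}" "T \<noteq> {}" "Y - T \<noteq> {}"
      using A T card kt card_mono[of T Y] by auto
  qed
  then show ?thesis
    using iso by simp
qed

section \<open>The theorem\<close>

lemma card_non_adj_pairs_less_if_q_radius_ge:
  assumes bip: "bipartite_graph X Y E" and card: "card X = n" "card Y = n"
    and deg: "\<And>v. v \<in> X \<union> Y \<Longrightarrow> 0 < degree (X \<union> Y) E v"
    and kt: "0 < t" "t \<le> k" and n: "(k + 2) * (t + 1) \<le> n"
    and q: "q_M n k t \<le> q_radius (X \<union> Y) E"
  shows "card (non_adj_pairs X Y E) < (t + 1) * (n - k - 2)"
proof -
  let ?e = "card (adj_pairs X Y E)"
  have k_n: "k + 2 \<le> n"
    by (rule le_trans[OF _ n]) simp
  have "2 * real n - t < q_radius (X \<union> Y) E"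
    using q_radius_M_gt[of k n t] q kt k_n by simp
  also have "\<dots> \<le> n + ?e / n"
    using k_n by (intro q_radius_le_edges[OF bip card _ deg]) auto
  finally have "real n - t < ?e / n"
    by simp
  then have "(real n - t) * n < ?e"
    using k_n by (subst (asm) pos_less_divide_eq) auto
  then have "real (n * n) < real (?e + n * t)"
    by (simp add: algebra_simps)
  then have "n * n < ?e + n * t"
    by (simp only: of_nat_less_iff)
  then have "card (non_adj_pairs X Y E) < n * t"
    using card_adj_pairs_add_non_adj_pairs[of X Y E] bipartite_graphD[OF bip] card by simp
  also obtain j where "n = k + 2 + j"
    using k_n le_Suc_ex by blast
  then have "n * t \<le> (t + 1) * (n - k - 2)"
    using n by (simp add: algebra_simps)
  finally show ?thesis .
qed

lemma degree_le_degree_delete: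
  assumes bip: "bipartite_graph X Y E" and W: "card (W \<inter> X) = p" "card (W \<inter> Y) = p"
    and x: "x \<in> X \<union> Y - W"
  shows "degree (X \<union> Y) E x \<le> degree (X \<union> Y - W) (induced_edges E (- W)) x + p"
proof -
  note fin = bipartite_graphD[OF bip]
  have "degree (X \<union> Y - W) (induced_edges E (- W)) x = degree (X \<union> Y - W) E x"
    using x by (auto simp: degree_def adj_induced_edges intro!: arg_cong[of _ _ card])
  moreover have "nbhd (X \<union> Y) E x \<inter> W \<subseteq> W \<inter> Y \<or> nbhd (X \<union> Y) E x \<inter> W \<subseteq> W \<inter> X"
    using x by (auto simp: nbhd_bipartite[OF bip])
  then have "card (nbhd (X \<union> Y) E x \<inter> W) \<le> p"
    using card_mono[of "W \<inter> Y"] card_mono[of "W \<inter> X"] fin W by (metis finite_Int)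
  ultimately show ?thesis
    using degree_eq_degree_Diff[of "X \<union> Y" E x W] fin by simp
qed

lemma low_degree_structure_undelete:
  assumes bip: "bipartite_graph X Y E" and W: "card (W \<inter> X) = p" "card (W \<inter> Y) = p"
    and low: "low_degree_structure (X - W) (Y - W) (induced_edges E (- W)) t s"
  shows "low_degree_structure X Y E t (s + p)"
proof -
  let ?d = "degree ((X - W) \<union> (Y - W)) (induced_edges E (- W))"
  have V: "(X - W) \<union> (Y - W) = X \<union> Y - W"
    by auto
  have degree_le: "degree (X \<union> Y) E x \<le> s + p" if "x \<in> X \<union> Y - W" "?d x \<le> s" for x
    using degree_le_degree_delete[OF bip W that(1)] that(2) by (simp add: V)
  consider T where "T \<subseteq> X - W \<or> T \<subseteq> Y - W" "card T = t" "\<forall>x\<in>T. ?d x \<le> s"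
    | x y where "t = 2" "x \<in> X - W" "y \<in> Y - W" "adj (induced_edges E (- W)) x y" "?d x \<le> s" "?d y \<le> s"
    using low unfolding low_degree_structure_def by metis
  then show ?thesis
  proof cases
    case 1
    then have "\<forall>x\<in>T. degree (X \<union> Y) E x \<le> s + p" "T \<subseteq> X \<or> T \<subseteq> Y"
      using degree_le by blast+
    with 1(2) show ?thesis
      unfolding low_degree_structure_def by blast
  next
    case 2
    then have "degree (X \<union> Y) E x \<le> s + p" "degree (X \<union> Y) E y \<le> s + p" "adj E x y"
      using degree_le by (auto simp: adj_induced_edges)
    with 2(1-3) show ?thesis
      unfolding low_degree_structure_def by blast
  qed
qed

lemma not_ham_biconnected_2pE:
  assumes bip: "bipartite_graph X Y E" and not_ham: "\<not> ham_biconnected_2p p X Y E"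
  obtains W u v where "card (W \<inter> X) = p" "card (W \<inter> Y) = p" "u \<in> X - W" "v \<in> Y - W"
    "\<nexists>ps. ham_path (induced_edges E (- W)) ((X - W) \<union> (Y - W)) u v ps"
proof -
  note fin = bipartite_graphD[OF bip]
  obtain W u v where W: "W \<subseteq> X \<union> Y" "card (W \<inter> X) = card (W \<inter> Y)" "card W = 2 * p"
    and uv: "u \<in> X - W" "v \<in> Y - W" and no: "\<nexists>ps. ham_path E ((X - W) \<union> (Y - W)) u v ps"
    using not_ham unfolding ham_biconnected_2p_def ham_biconnected_def by blast
  have "card W = card (W \<inter> X) + card (W \<inter> Y)"
    using W(1) fin
    by (subst card_Un_disjoint[symmetric]) (auto simp flip: Int_Un_distrib simp: Int_absorb2)
  then have "card (W \<inter> X) = p" "card (W \<inter> Y) = p"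
    using W by auto
  moreover have "\<nexists>ps. ham_path (induced_edges E (- W)) ((X - W) \<union> (Y - W)) u v ps"
    using no ham_path_induced_edges[of "(X - W) \<union> (Y - W)" "- W" E u v] by blast
  ultimately show thesis
    using that uv by blast
qed

lemma low_degree_structure_if_not_ham_biconnected_2p:
  assumes bip: "bipartite_graph X Y E" and card: "card X = n" "card Y = n"
    and deg: "\<And>v. v \<in> X \<union> Y \<Longrightarrow> t + p \<le> degree (X \<union> Y) E v" and t: "1 \<le> t"
    and few: "card (non_adj_pairs X Y E) < (t + 1) * (n - (t + p) - 2)"
    and not_ham: "\<not> ham_biconnected_2p p X Y E"
  shows "low_degree_structure X Y E t (t + p)"
proof -
  note fin = bipartite_graphD[OF bip]
  obtain W u v where W: "card (W \<inter> X) = p" "card (W \<inter> Y) = p" and uv: "u \<in> X - W" "v \<in> Y - W"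
    and no: "\<nexists>ps. ham_path (induced_edges E (- W)) ((X - W) \<union> (Y - W)) u v ps"
    by (rule not_ham_biconnected_2pE[OF bip not_ham])
  let ?E = "induced_edges E (- W)"
  have V: "(X - W) \<union> (Y - W) = X \<union> Y - W"
    by auto
  have "low_degree_structure (X - W) (Y - W) ?E t t"
  proof (rule low_degree_structure_if_no_ham_path[OF _ _ _ uv _ t _ no])
    show "bipartite_graph (X - W) (Y - W) ?E"
      using bipartite_graph_induced[OF bip, of "- W"] by (simp add: Diff_eq)
    show "card (X - W) = n - p" "card (Y - W) = n - p"
      using card W fin by (simp_all add: card_Diff_subset_Int Int_commute)
    show "t \<le> degree ((X - W) \<union> (Y - W)) ?E x" if "x \<in> (X - W) \<union> (Y - W)" for x
      using degree_le_degree_delete[OF bip W, of x] deg[of x] that by (auto simp: V)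
    have "non_adj_pairs (X - W) (Y - W) ?E \<subseteq> non_adj_pairs X Y E"
      by (auto simp: non_adj_pairs_def adj_induced_edges)
    then have "card (non_adj_pairs (X - W) (Y - W) ?E) \<le> card (non_adj_pairs X Y E)"
      using fin by (intro card_mono finite_non_adj_pairs)
    then show "card (non_adj_pairs (X - W) (Y - W) ?E) < (t + 1) * (n - p - t - 2)"
      using few by (simp add: add.commute)
  qed
  then show ?thesis
    by (rule low_degree_structure_undelete[OF bip W])
qed

lemma graph_iso_M_if_low_degree_structure:
  assumes bip: "bipartite_graph X Y E" and card: "card X = n" "card Y = n"
    and kt: "0 < t" "t \<le> k" and n: "(k + 2) * (t + 1) \<le> n"
    and q: "q_M n k t \<le> q_radius (X \<union> Y) E"
    and low: "low_degree_structure X Y E t k"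
  shows "graph_iso (X \<union> Y) E (M_X n \<union> M_Y n) (M_E n n (n - k) t)"
proof -
  have n_k: "k + 2 \<le> n"
    by (rule le_trans[OF _ n]) simp
  then have bounds: "0 < k" "k \<le> n" "0 < t" "t < n"
    using kt by auto
  consider T where "T \<subseteq> Y" "card T = t" "\<forall>x\<in>T. degree (X \<union> Y) E x \<le> k"
    | T where "T \<subseteq> X" "card T = t" "\<forall>x\<in>T. degree (X \<union> Y) E x \<le> k"
    | x y where "t = 2" "x \<in> X" "y \<in> Y" "adj E x y" "degree (X \<union> Y) E x \<le> k" "degree (X \<union> Y) E y \<le> k"
    using low unfolding low_degree_structure_def by metis
  then show ?thesis
  proof cases
    case 1
    then show ?thesis
      using graph_iso_M_if_low_side[OF bip card _ _ _ bounds q] by blast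
  next
    case 2
    then show ?thesis
      using graph_iso_M_if_low_side[OF bipartite_graph_sym[OF bip] card(2,1) _ _ _ bounds] q
      by (simp add: Un_commute)
  next
    case 3
    have "3 * (k + 2) \<le> n" "2 \<le> k" "k + 3 < 2 * n"
      using n n_k 3(1) kt by auto
    then have "q_radius (X \<union> Y) E < q_M n k t"
      using q_radius_le_low_edge[OF bip card _ _ 3(2-6)] q_radius_M_two_gt[of k n] 3(1) by simp
    then show ?thesis
      using q by simp
  qed
qed

theorem theorem1p6:
  fixes X Y :: "'a set" and E :: "'a set set" and n k p :: nat
  assumes "bipartite_graph X Y E"
    and "card X = n" and "card Y = n"
    and "\<forall>v\<in>X \<union> Y. degree (X \<union> Y) E v \<ge> k"
    and "n \<ge> (k + 2) * (k - p + 1)"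
    and "k \<ge> p + 1"
    and "q_radius (X \<union> Y) E \<ge> q_radius (M_X n \<union> M_Y n) (M_E n n (n - k) (k - p))"
  shows "ham_biconnected_2p p X Y E \<or>
         graph_iso (X \<union> Y) E (M_X n \<union> M_Y n) (M_E n n (n - k) (k - p))"
proof (rule disjCI)
  assume not_iso: "\<not> graph_iso (X \<union> Y) E (M_X n \<union> M_Y n) (M_E n n (n - k) (k - p))"
  define t where "t = k - p"
  have k: "k = t + p" "0 < t" "t \<le> k" and n: "(k + 2) * (t + 1) \<le> n"
    using assms(5,6) by (auto simp: t_def)
  have deg: "t + p \<le> degree (X \<union> Y) E v" if "v \<in> X \<union> Y" for v
    using assms(4) that by (simp add: k(1))
  note q = assms(7)[folded t_def]
  have pos: "0 < degree (X \<union> Y) E v" if "v \<in> X \<union> Y" for v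
    using deg[OF that] k(2) by simp
  have few: "card (non_adj_pairs X Y E) < (t + 1) * (n - (t + p) - 2)"
    using card_non_adj_pairs_less_if_q_radius_ge[OF assms(1-3) pos k(2,3) n q] by (simp only: k(1))
  show "ham_biconnected_2p p X Y E"
  proof (rule ccontr)
    assume "\<not> ?thesis"
    then have "low_degree_structure X Y E t k"
      using low_degree_structure_if_not_ham_biconnected_2p[OF assms(1-3) deg _ few] k by simp
    from graph_iso_M_if_low_degree_structure[OF assms(1-3) k(2,3) n q this] not_iso
    show False
      by (simp add: t_def)
  qed
qed

end
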